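(* Let $G$ be a $5$-regular graph that has no $\{4,1\}$-factor, and which is vertex-minimal with this property (every $5$-regular graph with fewer vertices than $G$ has a $\{4,1\}$-factor). Then: (a) $G$ is connected. (b) $G$ is not $4$-edge-connected, i.e., $G$ contains an edge cut on $3$ edges. (c) $G$ has no minimal edge cut of size $2$. (d) $G$ does not have two bridges. (e) Each bridge in $G$ has precisely one endpoint incident to two loops. (f) The edges of any minimal edge cut of size $3$ in $G$ have a vertex in common, and this vertex is incident to a loop.
   Context: All graphs are finite, undirected pseudographs (multiple edges and loops allowed; a loop contributes $2$ to the degree). For a set $S$ of integers, an $S$-factor of a graph is a spanning subgraph in which the degree of every vertex lies in $S$; thus a $\{4,1\}$-factor is a spanning subgraph in which every vertex has degree $4$ or $1$. A set $S$ of edges of a connected graph $G$ is an edge cut if $G-S$ is disconnected; it is minimal if $G-(S\setminus\{e\})$ is connected for every $e\in S$. A bridge is an edge cut of size $1$. *)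

theory Defs
  imports Main "HOL-Library.Multiset"
begin

text \<open>Every edge is mapped to the two-element multiset of its ends; a loop at \<open>v\<close> has the ends
  \<open>{#v, v#}\<close>. Parallel edges are distinct edges with the same ends.\<close>

record ('v, 'e) pgraph =
  verts :: "'v set"
  edges :: "'e set"
  ends :: "'e \<Rightarrow> 'v multiset"

definition pseudograph :: "('v, 'e) pgraph \<Rightarrow> bool" where
  "pseudograph G \<longleftrightarrow> finite (verts G) \<and> finite (edges G) \<and>
     (\<forall>e \<in> edges G. size (ends G e) = 2 \<and> set_mset (ends G e) \<subseteq> verts G)"

definition loops_at :: "('v, 'e) pgraph \<Rightarrow> 'v \<Rightarrow> 'e set" where
  "loops_at G v = {e \<in> edges G. ends G e = {#v, v#}}"

text \<open>The multiplicity of \<open>v\<close> among the ends of a loop at \<open>v\<close> is 2, so loops count twice.\<close>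

definition vertex_degree :: "('v, 'e) pgraph \<Rightarrow> 'v \<Rightarrow> nat" where
  "vertex_degree G v = (\<Sum>e \<in> edges G. count (ends G e) v)"

definition regular :: "nat \<Rightarrow> ('v, 'e) pgraph \<Rightarrow> bool" where
  "regular k G \<longleftrightarrow> (\<forall>v \<in> verts G. vertex_degree G v = k)"

definition spanning_subgraph :: "('v, 'e) pgraph \<Rightarrow> ('v, 'e) pgraph \<Rightarrow> bool" where
  "spanning_subgraph H G \<longleftrightarrow> verts H = verts G \<and> edges H \<subseteq> edges G \<and>
     (\<forall>e \<in> edges H. ends H e = ends G e)"

definition is_factor :: "nat set \<Rightarrow> ('v, 'e) pgraph \<Rightarrow> ('v, 'e) pgraph \<Rightarrow> bool" where
  "is_factor S H G \<longleftrightarrow> spanning_subgraph H G \<and> (\<forall>v \<in> verts H. vertex_degree H v \<in> S)"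

definition has_factor :: "nat set \<Rightarrow> ('v, 'e) pgraph \<Rightarrow> bool" where
  "has_factor S G \<longleftrightarrow> (\<exists>H. is_factor S H G)"

definition adj :: "('v, 'e) pgraph \<Rightarrow> ('v \<times> 'v) set" where
  "adj G = {(u, v). \<exists>e \<in> edges G. ends G e = {#u, v#}}"

definition graph_connected :: "('v, 'e) pgraph \<Rightarrow> bool" where
  "graph_connected G \<longleftrightarrow> verts G \<noteq> {} \<and> (\<forall>u \<in> verts G. \<forall>v \<in> verts G. (u, v) \<in> (adj G)\<^sup>*)"

definition del_edges :: "('v, 'e) pgraph \<Rightarrow> 'e set \<Rightarrow> ('v, 'e) pgraph" where
  "del_edges G S = G\<lparr>edges := edges G - S\<rparr>"

definition edge_cut :: "('v, 'e) pgraph \<Rightarrow> 'e set \<Rightarrow> bool" where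
  "edge_cut G S \<longleftrightarrow> graph_connected G \<and> S \<subseteq> edges G \<and> \<not> graph_connected (del_edges G S)"

definition minimal_edge_cut :: "('v, 'e) pgraph \<Rightarrow> 'e set \<Rightarrow> bool" where
  "minimal_edge_cut G S \<longleftrightarrow> edge_cut G S \<and> (\<forall>e \<in> S. graph_connected (del_edges G (S - {e})))"

definition bridge :: "('v, 'e) pgraph \<Rightarrow> 'e \<Rightarrow> bool" where
  "bridge G e \<longleftrightarrow> edge_cut G {e}"

definition edge_connected :: "nat \<Rightarrow> ('v, 'e) pgraph \<Rightarrow> bool" where
  "edge_connected k G \<longleftrightarrow> graph_connected G \<and> (\<forall>S. edge_cut G S \<longrightarrow> k \<le> card S)"

text \<open>The graphs \<open>H\<close> range over all finite pseudographs up to isomorphism, since each of them has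
  a copy whose vertices and edges are natural numbers; the types \<open>'v\<close> and \<open>'e\<close> are arbitrary.\<close>

definition vertex_minimal_without_factor :: "nat \<Rightarrow> nat set \<Rightarrow> ('v, 'e) pgraph \<Rightarrow> bool" where
  "vertex_minimal_without_factor k S G \<longleftrightarrow>
     pseudograph G \<and> regular k G \<and> \<not> has_factor S G \<and>
     (\<forall>H :: (nat, nat) pgraph.
        pseudograph H \<and> regular k H \<and> card (verts H) < card (verts G) \<longrightarrow> has_factor S H)"

end

theory Submission
  imports Defs
begin

text \<open>For a vertex set \<open>X\<close> call a set \<open>T\<close> of boundary edges extendable if some edge set meets the boundary
  in exactly \<open>T\<close> and has degree 4 or 1 at every vertex of \<open>X\<close>. Two facts drive the proof. If \<open>T\<close> is
  extendable on both sides of a cut, then \<open>G\<close> has a factor. As \<open>5 - 4 = 1\<close>, complementation shows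
  that the boundary edges outside \<open>T\<close> are extendable whenever \<open>T\<close> is. Replacing one side of a small
  cut by at most one vertex gives a smaller 5-regular graph; its factors show which patterns are
  extendable, and up to complementation the two sides always share one. For a cut of size 3 with at
  least two vertices on each side, the two possible replacements show that some singleton is
  extendable, and that either the empty pattern or every singleton is.

  An edge cut of size at most 3 exists because otherwise every vertex set of odd size has at least 5
  boundary edges, so that Tutte's theorem yields a perfect matching, which is a factor.\<close>

subsection \<open>Perfect matchings and Tutte's condition\<close>

text \<open>A matching is encoded by its partner function, a fixed-point-free involution of
  \<open>A\<close> that moves along \<open>E\<close>.\<close>

definition perfect_matching_on :: "('a \<Rightarrow> 'a \<Rightarrow> bool) \<Rightarrow> 'a set \<Rightarrow> ('a \<Rightarrow> 'a) \<Rightarrow> bool" where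
  "perfect_matching_on E A f \<longleftrightarrow> (\<forall>x\<in>A. f x \<in> A \<and> f (f x) = x \<and> f x \<noteq> x \<and> E x (f x))"

definition matchable :: "('a \<Rightarrow> 'a \<Rightarrow> bool) \<Rightarrow> 'a set \<Rightarrow> bool" where
  "matchable E A \<longleftrightarrow> (\<exists>f. perfect_matching_on E A f)"

text \<open>The family \<open>\<C>\<close> replaces the odd components of \<open>V - S\<close>. Its members need not be connected, so
  that the condition is visibly monotone in \<open>E\<close>.\<close>

definition tutte_condition :: "('a \<Rightarrow> 'a \<Rightarrow> bool) \<Rightarrow> 'a set \<Rightarrow> bool" where
  "tutte_condition E V \<longleftrightarrow>
     (\<forall>S \<C>. S \<subseteq> V \<longrightarrow>
        (\<forall>C\<in>\<C>. C \<subseteq> V - S \<and> odd (card C) \<and> (\<forall>x\<in>C. \<forall>y\<in>V - S. E x y \<longrightarrow> y \<in> C)) \<longrightarrow>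
        pairwise disjnt \<C> \<longrightarrow> card \<C> \<le> card S)"

section \<open>Unions of matchings and matchings in cliques\<close>

lemma matchable_empty: "matchable E {}"
  by (simp add: matchable_def perfect_matching_on_def)

lemma matchable_Un:
  assumes "matchable E A" "matchable E B" "A \<inter> B = {}"
  shows "matchable E (A \<union> B)"
proof -
  obtain f g where f: "perfect_matching_on E A f" and g: "perfect_matching_on E B g"
    using assms unfolding matchable_def by blast
  have "perfect_matching_on E (A \<union> B) (\<lambda>x. if x \<in> A then f x else g x)"
    unfolding perfect_matching_on_def
  proof
    fix x assume "x \<in> A \<union> B"
    then consider "x \<in> A" | "x \<in> B" "x \<notin> A" by auto
    then show "(if x \<in> A then f x else g x) \<in> A \<union> B \<and>
        (if (if x \<in> A then f x else g x) \<in> A then f (if x \<in> A then f x else g x)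
         else g (if x \<in> A then f x else g x)) = x \<and>
        (if x \<in> A then f x else g x) \<noteq> x \<and> E x (if x \<in> A then f x else g x)"
    proof cases
      case 1
      then show ?thesis using f by (simp add: perfect_matching_on_def)
    next
      case 2
      then have "g x \<in> B" "g x \<notin> A"
        using g assms(3) by (auto simp: perfect_matching_on_def)
      then show ?thesis using g 2 by (simp add: perfect_matching_on_def)
    qed
  qed
  then show ?thesis unfolding matchable_def by blast
qed

lemma matchable_pair:
  assumes "E x y" "E y x" "x \<noteq> y"
  shows "matchable E {x, y}"
proof -
  have "perfect_matching_on E {x, y} (\<lambda>z. if z = x then y else x)"
    using assms by (auto simp: perfect_matching_on_def)
  then show ?thesis unfolding matchable_def by blast
qed

lemma matchable_even_clique:
  assumes "finite A" "even (card A)" "\<And>x y. x \<in> A \<Longrightarrow> y \<in> A \<Longrightarrow> x \<noteq> y \<Longrightarrow> E x y"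
  shows "matchable E A"
  using assms
proof (induction "card A" arbitrary: A rule: less_induct)
  case less
  show ?case
  proof (cases "A = {}")
    case True
    then show ?thesis by (simp add: matchable_empty)
  next
    case False
    then obtain x where x: "x \<in> A" by blast
    have "A \<noteq> {x}" using less.prems(2) by auto
    then obtain y where y: "y \<in> A" "y \<noteq> x" using x by blast
    have c: "card (A - {x, y}) = card A - 2" "card A \<ge> 2"
    proof -
      show "card (A - {x, y}) = card A - 2"
        using x y less.prems(1) by (simp add: card_Diff_subset)
      have "card {x, y} \<le> card A" using x y less.prems(1) by (intro card_mono) auto
      then show "card A \<ge> 2" using y by simp
    qed
    have "matchable E (A - {x, y})"
      using less.prems c by (intro less.hyps) auto
    moreover have "matchable E {x, y}"
      using x y less.prems(3) by (intro matchable_pair) auto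
    ultimately have "matchable E ((A - {x, y}) \<union> {x, y})"
      by (rule matchable_Un) auto
    moreover have "(A - {x, y}) \<union> {x, y} = A" using x y by auto
    ultimately show ?thesis by simp
  qed
qed

text \<open>Each odd clique gives up one vertex to a partner in \<open>S\<close>, and the bound on
  the odd cliques supplies enough partners. What remains of every clique is even, and the leftover
  of \<open>S\<close> is itself an even clique. The induction removes one clique at a time.\<close>

lemma matchable_cliques_with_universal:
  assumes "finite \<D>" "finite S" "\<And>D. D \<in> \<D> \<Longrightarrow> finite D"
    and "pairwise disjnt \<D>" "\<Union>\<D> \<inter> S = {}"
    and "\<And>D x y. D \<in> \<D> \<Longrightarrow> x \<in> D \<Longrightarrow> y \<in> D \<Longrightarrow> x \<noteq> y \<Longrightarrow> E x y"
    and "\<And>x y. x \<in> S \<Longrightarrow> y \<in> \<Union>\<D> \<union> S \<Longrightarrow> x \<noteq> y \<Longrightarrow> E x y \<and> E y x"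
    and "card {D \<in> \<D>. odd (card D)} \<le> card S" "even (card (\<Union>\<D> \<union> S))"
  shows "matchable E (\<Union>\<D> \<union> S)"
  using assms
proof (induction \<D> arbitrary: S rule: finite_induct)
  case empty
  then show ?case by (auto intro!: matchable_even_clique)
next
  case (insert D \<D>)
  have finD: "finite D" and fin: "finite (\<Union>\<D>)" using insert.hyps insert.prems(2) by auto
  have disj: "D \<inter> \<Union>\<D> = {}"
  proof -
    have "disjnt D D'" if "D' \<in> \<D>" for D'
      using insert.prems(3) insert.hyps(2) that by (auto simp: pairwise_def)
    then show ?thesis by (auto simp: disjnt_def)
  qed
  have disjS: "D \<inter> S = {}" "\<Union>\<D> \<inter> S = {}" using insert.prems(4) by auto
  have pw: "pairwise disjnt \<D>" using insert.prems(3) by (auto simp: pairwise_insert)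
  have card_split: "card (\<Union>(insert D \<D>) \<union> S) = card D + card (\<Union>\<D> \<union> S)"
  proof -
    have "\<Union>(insert D \<D>) \<union> S = D \<union> (\<Union>\<D> \<union> S)" by auto
    then show ?thesis
      using disj disjS finD fin insert.prems(1) by (simp add: card_Un_disjoint Int_Un_distrib)
  qed
  show ?case
  proof (cases "even (card D)")
    case True
    have "{X \<in> insert D \<D>. odd (card X)} = {X \<in> \<D>. odd (card X)}" using True by auto
    then have card_odd: "card {X \<in> \<D>. odd (card X)} \<le> card S"
      using insert.prems(7) by simp
    have m1: "matchable E (\<Union>\<D> \<union> S)"
    proof (rule insert.IH)
      show "finite X" if "X \<in> \<D>" for X using that insert.prems(2) by blast
      show "E x y" if "X \<in> \<D>" "x \<in> X" "y \<in> X" "x \<noteq> y" for X x y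
        using that insert.prems(5) by blast
      show "E x y \<and> E y x" if "x \<in> S" "y \<in> \<Union>\<D> \<union> S" "x \<noteq> y" for x y
        using that by (intro insert.prems(6)) auto
      show "even (card (\<Union>\<D> \<union> S))" using insert.prems(8) card_split True by simp
    qed (use insert.prems(1) pw disjS(2) card_odd in auto)
    have m2: "matchable E D"
      using finD True insert.prems(5) by (intro matchable_even_clique) auto
    have "matchable E (D \<union> (\<Union>\<D> \<union> S))"
      using disj disjS by (intro matchable_Un[OF m2 m1]) auto
    moreover have "D \<union> (\<Union>\<D> \<union> S) = \<Union>(insert D \<D>) \<union> S" by auto
    ultimately show ?thesis by simp
  next
    case False
    then obtain r where r: "r \<in> D" by fastforce
    have "{X \<in> insert D \<D>. odd (card X)} = insert D {X \<in> \<D>. odd (card X)}" using False by auto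
    then have cardodd: "card {X \<in> insert D \<D>. odd (card X)} = Suc (card {X \<in> \<D>. odd (card X)})"
      using insert.hyps by simp
    \<comment> \<open>\<open>D\<close> itself counts as an odd clique, so the bound forces
      \<open>S\<close> to be nonempty; \<open>s\<close> becomes the partner of the surplus vertex
      \<open>r\<close>.\<close>
    then have "card S \<noteq> 0" using insert.prems(7) by linarith
    then obtain s where s: "s \<in> S" by fastforce
    have rs: "r \<noteq> s" using r s disjS by auto
    have cS: "card (S - {s}) = card S - 1" "card S > 0"
      using s insert.prems(1) by (auto simp: card_gt_0_iff)
    have "\<Union>\<D> \<union> S = insert s (\<Union>\<D> \<union> (S - {s}))" using s by auto
    moreover have "s \<notin> \<Union>\<D> \<union> (S - {s})" using s disjS by auto
    ultimately have card_s: "card (\<Union>\<D> \<union> S) = Suc (card (\<Union>\<D> \<union> (S - {s})))"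
      using fin insert.prems(1) by simp
    have m1: "matchable E (\<Union>\<D> \<union> (S - {s}))"
    proof (rule insert.IH)
      show "finite X" if "X \<in> \<D>" for X using that insert.prems(2) by blast
      show "E x y" if "X \<in> \<D>" "x \<in> X" "y \<in> X" "x \<noteq> y" for X x y
        using that insert.prems(5) by blast
      show "E x y \<and> E y x" if "x \<in> S - {s}" "y \<in> \<Union>\<D> \<union> (S - {s})" "x \<noteq> y" for x y
        using that by (intro insert.prems(6)) auto
      show "even (card (\<Union>\<D> \<union> (S - {s})))"
        using insert.prems(8) card_split card_s False by simp
      show "card {X \<in> \<D>. odd (card X)} \<le> card (S - {s})"
        using cardodd cS insert.prems(7) by linarith
    qed (use insert.prems(1) pw disjS(2) in auto)
    have m2: "matchable E (D - {r})"
      using finD False r insert.prems(5) by (intro matchable_even_clique) auto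
    have m3: "matchable E {r, s}"
      using r s rs insert.prems(6)[of s r] by (intro matchable_pair) auto
    have "matchable E ({r, s} \<union> ((D - {r}) \<union> (\<Union>\<D> \<union> (S - {s}))))"
      using disj disjS r s by (intro matchable_Un[OF m3 matchable_Un[OF m2 m1]]) auto
    moreover have "{r, s} \<union> ((D - {r}) \<union> (\<Union>\<D> \<union> (S - {s}))) = \<Union>(insert D \<D>) \<union> S"
      using r s by auto
    ultimately show ?thesis by simp
  qed
qed

section \<open>The exchange argument between matchings of two augmented graphs\<close>

lemma perfect_matching_drop_edge:
  assumes "perfect_matching_on E' V f" "\<And>x y. E' x y \<Longrightarrow> E x y \<or> {x, y} = {a, c}" "a \<in> V" "f a \<noteq> c"
  shows "perfect_matching_on E V f"
  unfolding perfect_matching_on_def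
proof
  fix x assume x: "x \<in> V"
  have f: "f x \<in> V" "f (f x) = x" "f x \<noteq> x" "E' x (f x)"
    using assms(1) x by (auto simp: perfect_matching_on_def)
  \<comment> \<open>As \<open>f\<close> is an involution, using the extra edge would mean
    \<open>f a = c\<close>.\<close>
  have "{x, f x} \<noteq> {a, c}" using f assms(4) by (auto simp: doubleton_eq_iff)
  then show "f x \<in> V \<and> f (f x) = x \<and> f x \<noteq> x \<and> E x (f x)" using f assms(2) by blast
qed

text \<open>Following the two matchings alternately from \<open>d\<close> either reaches \<open>a\<close> or \<open>c\<close>, and the path found
  so far is closed up by an edge to \<open>b\<close>, or it returns to \<open>d\<close> along a cycle that avoids \<open>{a, c}\<close>.\<close>

lemma matchable_by_exchange:
  assumes "finite V"
    and f: "perfect_matching_on E1 V f" and g: "perfect_matching_on E2 V g"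
    and E1: "\<And>x y. E1 x y \<Longrightarrow> E x y \<or> {x, y} = {a, c}"
    and E2: "\<And>x y. E2 x y \<Longrightarrow> E x y \<or> {x, y} = {b, d}"
    and sym: "\<And>x y. E x y \<Longrightarrow> E y x"
    and "E a b" "E c b" "a \<noteq> b" "c \<noteq> b" "b \<noteq> d"
    and V: "a \<in> V" "b \<in> V" "c \<in> V" "d \<in> V"
  shows "matchable E V"
proof (cases "f a = c \<and> g b = d")
  case False
  then show ?thesis
    using perfect_matching_drop_edge[OF f E1 V(1)] perfect_matching_drop_edge[OF g E2 V(2)]
    unfolding matchable_def by blast
next
  case True
  have fV: "f x \<in> V" "f (f x) = x" "f x \<noteq> x" "E1 x (f x)" if "x \<in> V" for x
    using f that by (auto simp: perfect_matching_on_def)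
  have gV: "g x \<in> V" "g (g x) = x" "g x \<noteq> x" "E2 x (g x)" if "x \<in> V" for x
    using g that by (auto simp: perfect_matching_on_def)
  have fac: "f a = c" "f c = a" and gbd: "g b = d" "g d = b"
    using True fV(2)[OF V(1)] gV(2)[OF V(2)] by auto
  have Ef: "E x (f x)" if "x \<in> V" "x \<noteq> a" "x \<noteq> c" for x
    using E1[OF fV(4)[OF that(1)]] that by (auto simp: doubleton_eq_iff)
  have Eg: "E x (g x)" if "x \<in> V" "x \<noteq> b" "x \<noteq> d" for x
    using E2[OF gV(4)[OF that(1)]] that by (auto simp: doubleton_eq_iff)
  \<comment> \<open>The alternating path is \<open>d\<close>, \<open>f d\<close>,
    \<open>g (f d)\<close>, and so on; \<open>s\<close> lists every second vertex and
    \<open>f\<close> gives those in between.\<close>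
  define s where "s n = ((\<lambda>x. g (f x)) ^^ n) d" for n
  have s0: "s 0 = d" and sSuc: "s (Suc n) = g (f (s n))" for n
    by (auto simp: s_def)
  have sV: "s n \<in> V" for n
    by (induction n) (auto simp: s0 sSuc V fV gV)
  have gs: "g (s (Suc n)) = f (s n)" for n
    by (simp add: sSuc gV fV sV)
  \<comment> \<open>No vertex \<open>s m\<close> is also an intermediate vertex. Removing one step
    at each end of such a coincidence lowers the distance by 2, until \<open>f\<close> or
    \<open>g\<close> would have a fixed point.\<close>
  have s_neq: "s m \<noteq> f (s (m + k))" for m k
  proof (induction k arbitrary: m rule: less_induct)
    case (less k)
    show ?case
    proof
      assume eq: "s m = f (s (m + k))"
      then have eq': "f (s m) = s (m + k)" by (simp add: fV sV)
      consider "k = 0" | "k = 1" | k' where "k = Suc (Suc k')"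
        by (metis One_nat_def not0_implies_Suc)
      then show False
      proof cases
        case 1
        then show False using eq fV(3)[OF sV[of m]] by simp
      next
        case 2
        then have "g (f (s m)) = f (s m)" using eq' sSuc[of m] by (metis Suc_eq_plus1)
        then show False using gV(3)[OF fV(1)[OF sV]] by blast
      next
        case 3
        have "s (Suc m) = g (s (Suc (m + Suc k')))" unfolding sSuc[of m] eq' 3 by simp
        also have "\<dots> = f (s (Suc m + k'))" by (simp only: gs add_Suc add_Suc_right)
        finally show False using less.IH[of k' "Suc m"] 3 by simp
      qed
    qed
  qed
  \<comment> \<open>Otherwise \<open>d\<close>, the partner of \<open>b\<close> under
    \<open>g\<close>, would be an intermediate vertex \<open>f (s k)\<close>.\<close>
  have s_b: "s n \<noteq> b" for n
  proof
    assume b: "s n = b"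
    then obtain k where "n = Suc k" using s0 \<open>b \<noteq> d\<close> by (cases n) auto
    then have "f (s k) = s (0 + 0)" using gs[of k] b gbd s0 by simp
    then have "s 0 = f (s (0 + k))" by simp
    then show False using s_neq by blast
  qed
  \<comment> \<open>Both matchings are invertible, so a repetition can be traced back to the start:
    the path closes up at \<open>d\<close>.\<close>
  have inj: "m = n \<or> (\<exists>k>0. s k = d)" if "s m = s n" for m n
    using that
  proof (induction m arbitrary: n)
    case 0
    then show ?case using s0 by (metis gr0I)
  next
    case (Suc m)
    show ?case
    proof (cases n)
      case 0
      then show ?thesis using Suc.prems s0 by auto
    next
      case (Suc n')
      then have "f (s m) = f (s n')" using Suc.prems gs by metis
      then have "s m = s n'" using fV(2)[OF sV] by metis
      then show ?thesis using Suc.IH Suc by blast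
    qed
  qed
  show ?thesis
  proof (cases "\<exists>i. s i \<in> {a, c}")
    case True
    \<comment> \<open>\<open>q\<close> is the first of \<open>a\<close> and \<open>c\<close> on the
      path, and \<open>P\<close> is the part before it. The new matching is \<open>f\<close> on
      \<open>P\<close>, the edge from \<open>q\<close> to \<open>b\<close>, and \<open>g\<close> on
      the rest.\<close>
    define i where "i = (LEAST i. s i \<in> {a, c})"
    have i: "s i \<in> {a, c}"
      using LeastI_ex[OF True] unfolding i_def .
    have least: "s j \<notin> {a, c}" if "j < i" for j
      using that unfolding i_def by (rule not_less_Least)
    define q where "q = s i"
    have q: "q \<in> V" "E q b" "q \<noteq> b" "q \<in> {a, c}"
    proof -
      show "q \<in> V" "q \<in> {a, c}" using i sV[of i] by (auto simp: q_def)
      then have "q = a \<or> q = c" by simp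
      then show "E q b" "q \<noteq> b" using \<open>E a b\<close> \<open>E c b\<close> \<open>a \<noteq> b\<close> \<open>c \<noteq> b\<close> by metis+
    qed
    define P where "P = s ` {..<i} \<union> f ` s ` {..<i}"
    have PV: "P \<subseteq> V" using sV fV by (auto simp: P_def)
    have fP: "f x \<in> P" if "x \<in> P" for x using that fV(2)[OF sV] by (auto simp: P_def)
    have notP: "x \<notin> P" if "x \<in> {a, c}" for x
    proof
      assume "x \<in> P"
      then obtain j where j: "j \<in> {..<i}" "x = s j \<or> x = f (s j)" by (auto simp: P_def)
      moreover have "f x \<in> {a, c}" using that fac by blast
      ultimately have "s j \<in> {a, c}" using that fV(2)[OF sV[of j]] by metis
      then show False using least j(1) by blast
    qed
    then have acP: "a \<notin> P" "c \<notin> P" by auto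
    then have qP: "q \<notin> P" using q by auto
    \<comment> \<open>If \<open>b\<close> were some \<open>f (s j)\<close> with
      \<open>j < i\<close>, the path would return to \<open>d\<close> and be periodic, so that
      \<open>{a, c}\<close> would be met before index \<open>i\<close>.\<close>
    have bP: "b \<notin> P"
    proof
      assume "b \<in> P"
      then obtain j where j: "j < i" "b = s j \<or> b = f (s j)" by (auto simp: P_def)
      then have "b = f (s j)" using s_b[of j] by auto
      then have per: "s (Suc j) = d" using gbd(1) sSuc[of j] by simp
      have "s (Suc j + m) = s m" for m
      proof (induction m)
        case 0
        show ?case using per s0 by simp
      next
        case (Suc m)
        then show ?case by (simp only: add_Suc_right sSuc)
      qed
      from this[of "i - Suc j"] have "s (i - Suc j) = s i" using j by simp
      then show False using least[of "i - Suc j"] i j by simp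
    qed
    \<comment> \<open>\<open>g\<close> pairs \<open>d\<close> with \<open>b\<close> and each
      \<open>f (s j)\<close> with \<open>s (Suc j)\<close>, so it preserves
      \<open>P \<union> {q, b}\<close>.\<close>
    have gs_in: "g (s j) \<in> P \<union> {q, b}" if "j \<le> i" for j
    proof (cases j)
      case 0
      then show ?thesis using s0 gbd by simp
    next
      case (Suc k)
      then have "f (s k) \<in> P" using that unfolding P_def by auto
      then show ?thesis using gs[of k] Suc by simp
    qed
    have gfs_in: "g (f (s j)) \<in> P \<union> {q, b}" if "j < i" for j
      using sSuc[of j, symmetric] that
      by (cases "Suc j = i") (auto simp: P_def q_def)
    have gb_in: "g b \<in> P \<union> {q, b}"
    proof (cases "i = 0")
      case True
      then show ?thesis using gbd s0 by (simp add: q_def)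
    next
      case False
      then have "s 0 \<in> P" unfolding P_def by (intro UnI1 imageI) simp
      then show ?thesis using gbd s0 by simp
    qed
    have g_in: "g x \<in> P \<union> {q, b}" if "x \<in> P \<union> {q, b}" for x
    proof -
      from that consider j where "j \<le> i" "x = s j" | j where "j < i" "x = f (s j)" | "x = b"
        unfolding P_def q_def by (auto intro: less_imp_le)
      then show ?thesis using gs_in gfs_in gb_in by cases blast+
    qed
    have g_out: "g x \<notin> P \<union> {q, b}" if "x \<in> V" "x \<notin> P \<union> {q, b}" for x
      using g_in[of "g x"] gV(2) that by metis
    have d_in: "d \<in> P \<union> {q, b}" using gb_in gbd by simp
    have "perfect_matching_on E P f"
      unfolding perfect_matching_on_def
    proof
      fix x assume x: "x \<in> P"
      then have "x \<in> V" "x \<noteq> a" "x \<noteq> c" using PV acP by auto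
      then show "f x \<in> P \<and> f (f x) = x \<and> f x \<noteq> x \<and> E x (f x)" using fP[OF x] fV Ef by simp
    qed
    then have m1: "matchable E P" unfolding matchable_def by blast
    have m2: "matchable E {q, b}"
      by (rule matchable_pair[OF q(2) sym[OF q(2)] q(3)])
    have "perfect_matching_on E (V - (P \<union> {q, b})) g"
      unfolding perfect_matching_on_def
    proof
      fix x assume x: "x \<in> V - (P \<union> {q, b})"
      then have "x \<in> V" "x \<noteq> b" "x \<noteq> d" using d_in by auto
      then show "g x \<in> V - (P \<union> {q, b}) \<and> g (g x) = x \<and> g x \<noteq> x \<and> E x (g x)"
        using g_out[of x] gV[of x] Eg[of x] x by blast
    qed
    then have m3: "matchable E (V - (P \<union> {q, b}))" unfolding matchable_def by blast
    have "matchable E (P \<union> ({q, b} \<union> (V - (P \<union> {q, b}))))"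
      using qP bP by (intro matchable_Un[OF m1 matchable_Un[OF m2 m3]]) auto
    moreover have "P \<union> ({q, b} \<union> (V - (P \<union> {q, b}))) = V"
      using PV q(1) V(2) by blast
    ultimately show ?thesis by (simp only:)
  next
    case False
    \<comment> \<open>The path avoids \<open>a\<close> and \<open>c\<close>, so by finiteness it is
      a cycle through \<open>d\<close> and \<open>b\<close>, closed under both matchings:
      \<open>f\<close> is used on it and \<open>g\<close> elsewhere.\<close>
    define P where "P = range s \<union> f ` range s"
    have PV: "P \<subseteq> V" using sV fV by (auto simp: P_def)
    have fP: "f x \<in> P" if "x \<in> P" for x using that fV(2)[OF sV] by (auto simp: P_def)
    have notP: "x \<notin> P" if "x \<in> {a, c}" for x
    proof
      assume "x \<in> P"
      then obtain j where j: "j \<in> UNIV" "x = s j \<or> x = f (s j)" by (auto simp: P_def)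
      moreover have "f x \<in> {a, c}" using that fac by blast
      ultimately have "s j \<in> {a, c}" using that fV(2)[OF sV[of j]] by metis
      then show False using False by blast
    qed
    then have acP: "a \<notin> P" "c \<notin> P" by auto
    have "finite (range s)" using sV \<open>finite V\<close> by (auto intro: finite_subset)
    then have "\<not> inj s" using finite_imageD infinite_UNIV_nat by blast
    then obtain k where k: "k > 0" "s k = d" using inj unfolding inj_def by blast
    then obtain k' where k': "k = Suc k'" by (cases k) auto
    have bP: "b \<in> P" using gs[of k'] k k' gbd by (auto simp: P_def)
    have gs_in: "g (s j) \<in> P" for j
      by (cases j) (use s0 gbd bP gs in \<open>auto simp: P_def\<close>)
    have g_in: "g x \<in> P" if "x \<in> P" for x
      using that gs_in sSuc[symmetric] by (auto simp: P_def)
    have g_out: "g x \<notin> P" if "x \<in> V" "x \<notin> P" for x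
      using g_in[of "g x"] gV(2) that by metis
    have d_in: "d \<in> P" using s0 by (auto simp: P_def)
    have "perfect_matching_on E P f"
      unfolding perfect_matching_on_def
    proof
      fix x assume x: "x \<in> P"
      then have "x \<in> V" "x \<noteq> a" "x \<noteq> c" using PV acP by auto
      then show "f x \<in> P \<and> f (f x) = x \<and> f x \<noteq> x \<and> E x (f x)" using fP[OF x] fV Ef by simp
    qed
    then have "matchable E P" unfolding matchable_def by blast
    moreover have "perfect_matching_on E (V - P) g"
      unfolding perfect_matching_on_def
    proof
      fix x assume x: "x \<in> V - P"
      then have "x \<in> V" "x \<noteq> b" "x \<noteq> d" using d_in bP by auto
      then show "g x \<in> V - P \<and> g (g x) = x \<and> g x \<noteq> x \<and> E x (g x)"
        using g_out[of x] gV[of x] Eg[of x] x by blast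
    qed
    then have "matchable E (V - P)" unfolding matchable_def by blast
    ultimately have "matchable E (P \<union> (V - P))"
      by (intro matchable_Un) auto
    moreover have "P \<union> (V - P) = V" using PV by auto
    ultimately show ?thesis by simp
  qed
qed

section \<open>Tutte's theorem\<close>

lemma tutte_conditionD:
  assumes "tutte_condition E V" "S \<subseteq> V" "pairwise disjnt \<C>"
    and "\<And>C. C \<in> \<C> \<Longrightarrow> C \<subseteq> V - S" "\<And>C. C \<in> \<C> \<Longrightarrow> odd (card C)"
    and "\<And>C x y. C \<in> \<C> \<Longrightarrow> x \<in> C \<Longrightarrow> y \<in> V - S \<Longrightarrow> E x y \<Longrightarrow> y \<in> C"
  shows "card \<C> \<le> card S"
  using assms(1)[unfolded tutte_condition_def, rule_format, OF assms(2) _ assms(3)] assms(4-6)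
  by blast

lemma tutte_condition_mono:
  assumes "tutte_condition E V" "\<And>x y. E x y \<Longrightarrow> E' x y"
  shows "tutte_condition E' V"
  unfolding tutte_condition_def
proof (intro allI impI)
  fix S \<C>
  assume S: "S \<subseteq> V" and disj: "pairwise disjnt \<C>"
    and C: "\<forall>C\<in>\<C>. C \<subseteq> V - S \<and> odd (card C) \<and> (\<forall>x\<in>C. \<forall>y\<in>V - S. E' x y \<longrightarrow> y \<in> C)"
  show "card \<C> \<le> card S"
  proof (rule tutte_conditionD[OF assms(1) S disj])
    fix X x y
    assume "X \<in> \<C>" "x \<in> X" "y \<in> V - S" "E x y"
    then show "y \<in> X" using C assms(2)[OF \<open>E x y\<close>] by blast
  qed (use C in blast)+
qed

text \<open>Off the set \<open>S\<close> of universal vertices, being equal or adjacent is an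
  equivalence relation, so \<open>V - S\<close> splits into cliques. Tutte's condition for
  \<open>S\<close> bounds the number of odd ones.\<close>

lemma tutte_transitive_case:
  fixes E :: "'a \<Rightarrow> 'a \<Rightarrow> bool"
  assumes "finite V" "tutte_condition E V" and sym: "\<And>x y. E x y \<Longrightarrow> E y x"
    and S: "S = {v \<in> V. \<forall>w\<in>V. w \<noteq> v \<longrightarrow> E v w}"
    and tr: "\<And>x y z. x \<in> V - S \<Longrightarrow> y \<in> V - S \<Longrightarrow> z \<in> V - S \<Longrightarrow>
      x \<noteq> z \<Longrightarrow> x \<noteq> y \<Longrightarrow> y \<noteq> z \<Longrightarrow> E x y \<Longrightarrow> E y z \<Longrightarrow> E x z"
  shows "matchable E V"
proof -
  define cl where "cl x = {y \<in> V - S. y = x \<or> E x y}" for x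
  define \<D> where "\<D> = cl ` (V - S)"
  have SV: "S \<subseteq> V" by (auto simp: S)
  have univ: "E x y" if "x \<in> S" "y \<in> V" "x \<noteq> y" for x y
    using that by (auto simp: S)
  have tr': "E x z" if "x \<in> V - S" "y \<in> V - S" "z \<in> V - S" "x \<noteq> z" "x = y \<or> E x y" "y = z \<or> E y z" for x y z
    using tr[of x y z] that by blast
  have cl_eq: "cl x = cl y" if "x \<in> V - S" "y \<in> cl x" for x y
  proof -
    have y: "y \<in> V - S" "y = x \<or> E x y" using that(2) by (auto simp: cl_def)
    have y': "x = y \<or> E y x" using y(2) sym by blast
    show ?thesis
      using tr'[OF that(1) y(1)] tr'[OF y(1) that(1)] y y' that(1) unfolding cl_def by blast
  qed
  have un: "\<Union>\<D> = V - S" by (auto simp: \<D>_def cl_def)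
  have disj: "pairwise disjnt \<D>"
    unfolding pairwise_def \<D>_def disjnt_def using cl_eq by blast
  have closed: "y \<in> D" if "D \<in> \<D>" "x \<in> D" "y \<in> V - S" "E x y" for D x y
  proof -
    obtain u where u: "u \<in> V - S" "D = cl u" using \<open>D \<in> \<D>\<close> by (auto simp: \<D>_def)
    then have "D = cl x" using cl_eq that by blast
    then show ?thesis using that by (auto simp: cl_def)
  qed
  have clique: "E x y" if "D \<in> \<D>" "x \<in> D" "y \<in> D" "x \<noteq> y" for D x y
  proof -
    obtain u where u: "u \<in> V - S" "D = cl u" using \<open>D \<in> \<D>\<close> by (auto simp: \<D>_def)
    then have "D = cl x" using cl_eq that by blast
    then show ?thesis using that by (auto simp: cl_def)
  qed
  have VS: "\<Union>\<D> \<union> S = V" using un SV by auto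
  \<comment> \<open>Tutte's condition for the empty set and the family \<open>{V}\<close> rules out
    odd order.\<close>
  have even: "even (card V)"
  proof (rule ccontr)
    assume odd: "odd (card V)"
    have "card {V} \<le> card ({} :: 'a set)"
      by (rule tutte_conditionD[OF assms(2)]) (use odd in auto)
    then show False using odd by simp
  qed
  have "matchable E (\<Union>\<D> \<union> S)"
  proof (rule matchable_cliques_with_universal)
    show "finite \<D>" "finite S" using \<open>finite V\<close> SV by (auto simp: \<D>_def finite_subset)
    show "finite D" if "D \<in> \<D>" for D
    proof (rule finite_subset)
      show "D \<subseteq> V" using that un by blast
    qed (rule \<open>finite V\<close>)
    show "\<Union>\<D> \<inter> S = {}" using un by auto
    show "E x y \<and> E y x" if "x \<in> S" "y \<in> \<Union>\<D> \<union> S" "x \<noteq> y" for x y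
      using univ[of x y] sym that VS by blast
    show "even (card (\<Union>\<D> \<union> S))" using even VS by simp
    have pw: "pairwise disjnt {D \<in> \<D>. odd (card D)}"
      using disj by (auto simp: pairwise_def)
    show "card {D \<in> \<D>. odd (card D)} \<le> card S"
    proof (rule tutte_conditionD[OF assms(2) SV pw])
      show "C \<subseteq> V - S" if "C \<in> {D \<in> \<D>. odd (card D)}" for C
        using that unfolding un[symmetric] by blast
      show "odd (card C)" if "C \<in> {D \<in> \<D>. odd (card D)}" for C
        using that by simp
      show "y \<in> C" if "C \<in> {D \<in> \<D>. odd (card D)}" "x \<in> C" "y \<in> V - S" "E x y" for C x y
        using closed[of C x y] that by simp
    qed
    show "pairwise disjnt \<D>" by (rule disj)
    show "E x y" if "D \<in> \<D>" "x \<in> D" "y \<in> D" "x \<noteq> y" for D x y using clique that .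
  qed
  then show ?thesis using VS by simp
qed

text \<open>Lovasz's argument, by induction on the number of non-adjacent pairs. Adding a missing
  edge preserves the condition, so each graph with one more edge has a matching. Either adjacency is
  transitive off the universal vertices, or two such matchings can be combined.\<close>

theorem tutte_matchable:
  assumes "finite V" "tutte_condition E V" "\<And>x y. E x y \<Longrightarrow> E y x"
  shows "matchable E V"
  using assms(2,3)
proof (induction "card {(x, y) \<in> V \<times> V. \<not> E x y}" arbitrary: E rule: less_induct)
  case less
  define U where "U = {v \<in> V. \<forall>w\<in>V. w \<noteq> v \<longrightarrow> E v w}"
  have add_edge: "\<exists>f. perfect_matching_on (\<lambda>x y. E x y \<or> {x, y} = {u, v}) V f"
    if "u \<in> V" "v \<in> V" "\<not> E u v" for u v
  proof -
    let ?E = "\<lambda>x y. E x y \<or> {x, y} = {u, v}"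
    have "card {(x, y) \<in> V \<times> V. \<not> ?E x y} < card {(x, y) \<in> V \<times> V. \<not> E x y}"
    proof (rule psubset_card_mono)
      show "finite {(x, y) \<in> V \<times> V. \<not> E x y}"
        using \<open>finite V\<close> by (rule_tac finite_subset[of _ "V \<times> V"]) auto
      show "{(x, y) \<in> V \<times> V. \<not> ?E x y} \<subset> {(x, y) \<in> V \<times> V. \<not> E x y}"
        using that by blast
    qed
    moreover have "tutte_condition ?E V"
      by (rule tutte_condition_mono[OF less.prems(1)]) simp
    moreover have "?E y x" if "?E x y" for x y
      using that less.prems(2) by (auto simp: insert_commute)
    ultimately have "matchable ?E V" by (rule less.hyps)
    then show ?thesis by (simp add: matchable_def)
  qed
  show ?case
  proof (cases "\<exists>a b c. a \<in> V - U \<and> b \<in> V - U \<and> c \<in> V - U \<and> a \<noteq> c \<and> a \<noteq> b \<and> b \<noteq> c \<and>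
      E a b \<and> E b c \<and> \<not> E a c")
    case True
    then obtain a b c where abc: "a \<in> V - U" "b \<in> V - U" "c \<in> V - U" "a \<noteq> c" "a \<noteq> b" "b \<noteq> c"
      "E a b" "E b c" "\<not> E a c" by blast
    \<comment> \<open>Such a \<open>d\<close> exists because \<open>b\<close> is not universal. The
      added edges are \<open>{a, c}\<close> and \<open>{b, d}\<close>; the path \<open>a\<close>,
      \<open>b\<close>, \<open>c\<close> provides the closing edges at \<open>b\<close> for the
      exchange.\<close>
    then obtain d where d: "d \<in> V" "d \<noteq> b" "\<not> E b d" by (auto simp: U_def)
    obtain f where f: "perfect_matching_on (\<lambda>x y. E x y \<or> {x, y} = {a, c}) V f"
      using add_edge abc by blast
    obtain g where g: "perfect_matching_on (\<lambda>x y. E x y \<or> {x, y} = {b, d}) V g"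
      using add_edge abc d by blast
    show ?thesis
    proof (rule matchable_by_exchange[OF \<open>finite V\<close> f g])
      show "E x y \<or> {x, y} = {a, c}" if "E x y \<or> {x, y} = {a, c}" for x y using that .
      show "E x y \<or> {x, y} = {b, d}" if "E x y \<or> {x, y} = {b, d}" for x y using that .
      show "E c b" using abc less.prems(2) by blast
    qed (use abc d less.prems(2) in auto)
  next
    case False
    show ?thesis
    proof (rule tutte_transitive_case[OF \<open>finite V\<close> less.prems U_def])
      fix x y z
      assume "x \<in> V - U" "y \<in> V - U" "z \<in> V - U" "x \<noteq> z" "x \<noteq> y" "y \<noteq> z" "E x y" "E y z"
      with False show "E x z" by blast
    qed
  qed
qed

subsection \<open>Boundaries and partial factors\<close>

definition sub_degree :: "('v, 'e) pgraph \<Rightarrow> 'e set \<Rightarrow> 'v \<Rightarrow> nat" where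
  "sub_degree G F v = (\<Sum>e\<in>F. count (ends G e) v)"

text \<open>The size separates the edges avoiding \<open>X\<close> (0), those crossing its boundary
  (1) and those lying inside (2); loops in \<open>X\<close> are among the last.\<close>

definition ends_in :: "('v, 'e) pgraph \<Rightarrow> 'v set \<Rightarrow> 'e \<Rightarrow> 'v multiset" where
  "ends_in G X e = filter_mset (\<lambda>v. v \<in> X) (ends G e)"

definition boundary :: "('v, 'e) pgraph \<Rightarrow> 'v set \<Rightarrow> 'e set" where
  "boundary G X = {e \<in> edges G. size (ends_in G X e) = 1}"

definition touching :: "('v, 'e) pgraph \<Rightarrow> 'v set \<Rightarrow> 'e set" where
  "touching G X = {e \<in> edges G. ends_in G X e \<noteq> {#}}"

definition extendable :: "('v, 'e) pgraph \<Rightarrow> 'v set \<Rightarrow> 'e set \<Rightarrow> bool" where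
  "extendable G X T \<longleftrightarrow>
     (\<exists>F \<subseteq> edges G. F \<inter> boundary G X = T \<and> (\<forall>v\<in>X. sub_degree G F v \<in> {4, 1}))"

lemma extendableI:
  assumes "F \<subseteq> edges G" "F \<inter> boundary G X = T" "\<And>v. v \<in> X \<Longrightarrow> sub_degree G F v \<in> {4, 1}"
  shows "extendable G X T"
  unfolding extendable_def using assms by (intro exI[of _ F]) simp

lemma has_factor_iff:
  "has_factor S G \<longleftrightarrow> (\<exists>F \<subseteq> edges G. \<forall>v\<in>verts G. sub_degree G F v \<in> S)"
proof
  assume "has_factor S G"
  then obtain H where H: "is_factor S H G" by (auto simp: has_factor_def)
  then have "sub_degree G (edges H) v = vertex_degree H v" for v
    by (auto simp: sub_degree_def vertex_degree_def is_factor_def spanning_subgraph_def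
        intro!: sum.cong)
  then show "\<exists>F \<subseteq> edges G. \<forall>v\<in>verts G. sub_degree G F v \<in> S"
    using H by (auto simp: is_factor_def spanning_subgraph_def intro!: exI[of _ "edges H"])
next
  assume "\<exists>F \<subseteq> edges G. \<forall>v\<in>verts G. sub_degree G F v \<in> S"
  then obtain F where "F \<subseteq> edges G" "\<forall>v\<in>verts G. sub_degree G F v \<in> S" by blast
  then have "is_factor S \<lparr>verts = verts G, edges = F, ends = ends G\<rparr> G"
    by (simp add: is_factor_def spanning_subgraph_def vertex_degree_def sub_degree_def)
  then show "has_factor S G" by (auto simp: has_factor_def)
qed

lemma vertex_degree_eq: "vertex_degree G v = sub_degree G (edges G) v"
  by (simp add: vertex_degree_def sub_degree_def)

lemma count_ends_in: "v \<in> X \<Longrightarrow> count (ends_in G X e) v = count (ends G e) v"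
  by (simp add: ends_in_def)

lemma size_filter_mem_eq_sum:
  assumes "finite X"
  shows "size (filter_mset (\<lambda>v. v \<in> X) M) = (\<Sum>v\<in>X. count M v)"
proof (induction M)
  case (add x M)
  have "(\<Sum>v\<in>X. count (add_mset x M) v) = (\<Sum>v\<in>X. (if x = v then 1 else 0) + count M v)"
    by (rule sum.cong) auto
  then show ?case using add assms by (simp add: sum.distrib)
qed simp

lemma size_eq_2_mset:
  assumes "size M = 2"
  obtains a b where "M = {#a, b#}"
proof -
  obtain a N where "M = add_mset a N" "size N = Suc 0"
    using assms size_eq_Suc_imp_eq_union[of M 1] by auto
  moreover obtain b N' where "N = add_mset b N'" "size N' = 0"
    using \<open>size N = Suc 0\<close> size_eq_Suc_imp_eq_union[of N 0] by auto
  ultimately show thesis using that by auto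
qed

lemma size_ends_in: "finite X \<Longrightarrow> size (ends_in G X e) = (\<Sum>v\<in>X. count (ends G e) v)"
  by (simp add: ends_in_def size_filter_mem_eq_sum)

lemma pseudographD:
  assumes "pseudograph G"
  shows "finite (verts G)" "finite (edges G)"
    "e \<in> edges G \<Longrightarrow> size (ends G e) = 2" "e \<in> edges G \<Longrightarrow> set_mset (ends G e) \<subseteq> verts G"
  using assms by (auto simp: pseudograph_def)

lemma size_ends_in_Diff:
  assumes "pseudograph G" "e \<in> edges G" "X \<subseteq> verts G"
  shows "size (ends_in G X e) + size (ends_in G (verts G - X) e) = 2"
proof -
  have "ends_in G (verts G - X) e = filter_mset (\<lambda>v. v \<notin> X) (ends G e)"
    unfolding ends_in_def using pseudographD(4)[OF assms(1,2)] by (intro filter_mset_cong) auto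
  then have "ends_in G X e + ends_in G (verts G - X) e = ends G e"
    by (simp add: ends_in_def multiset_partition[symmetric])
  then show ?thesis
    using pseudographD(3)[OF assms(1,2)] by (metis size_union)
qed

lemma size_ends_in_le:
  assumes "pseudograph G" "e \<in> edges G"
  shows "size (ends_in G X e) \<le> 2"
  using size_filter_mset_lesseq[of _ "ends G e"] pseudographD(3)[OF assms]
  by (simp add: ends_in_def)

lemma boundary_Diff:
  assumes "pseudograph G" "X \<subseteq> verts G"
  shows "boundary G (verts G - X) = boundary G X"
  using size_ends_in_Diff[OF assms(1) _ assms(2)] by (fastforce simp: boundary_def)

lemma boundary_subset_edges: "boundary G X \<subseteq> edges G"
  by (auto simp: boundary_def)

lemma boundary_subset_touching: "boundary G X \<subseteq> touching G X"
  by (auto simp: boundary_def touching_def)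

lemma finite_boundary: "pseudograph G \<Longrightarrow> finite (boundary G X)"
  using boundary_subset_edges pseudographD(2) finite_subset by metis

lemma boundaryE:
  assumes "e \<in> boundary G X" "pseudograph G"
  obtains a b where "ends G e = {#a, b#}" "a \<in> X" "b \<notin> X" "a \<in> verts G" "b \<in> verts G"
proof -
  have e: "e \<in> edges G" "size (ends_in G X e) = 1" using assms by (auto simp: boundary_def)
  obtain a b where ab: "ends G e = {#a, b#}"
    using pseudographD(3)[OF assms(2) e(1)] by (rule size_eq_2_mset)
  have V: "a \<in> verts G" "b \<in> verts G" using pseudographD(4)[OF assms(2) e(1)] ab by auto
  have ba: "ends G e = {#b, a#}" using ab by (simp add: add_mset_commute)
  have "a \<in> X \<longleftrightarrow> b \<notin> X" using e(2) ab by (auto simp: ends_in_def split: if_splits)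
  then show thesis using that[OF ab] that[OF ba] V by blast
qed

lemma boundaryI:
  assumes "e \<in> edges G" "ends G e = {#a, b#}" "a \<in> X" "b \<notin> X"
  shows "e \<in> boundary G X"
  using assms by (simp add: boundary_def ends_in_def)

section \<open>Gluing and complementing partial factors\<close>

lemma sub_degree_touching:
  assumes "pseudograph G" "F \<subseteq> edges G" "v \<in> X"
  shows "sub_degree G F v = sub_degree G (F \<inter> touching G X) v"
  unfolding sub_degree_def
proof (rule sum.mono_neutral_right)
  show "finite F" using assms(1,2) pseudographD(2) finite_subset by metis
  show "\<forall>e\<in>F - F \<inter> touching G X. count (ends G e) v = 0"
  proof
    fix e assume "e \<in> F - F \<inter> touching G X"
    then have "ends_in G X e = {#}" using assms(2) by (auto simp: touching_def)
    then show "count (ends G e) v = 0" using count_ends_in[OF assms(3), of G e] by simp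
  qed
qed simp

text \<open>Take the first edge set on the edges meeting \<open>X\<close> and the second on those
  meeting the complement. Only boundary edges meet both sides, and there the two sets agree, so all
  degrees are kept.\<close>

lemma has_factor_glue:
  assumes G: "pseudograph G" and X: "X \<subseteq> verts G"
    and "extendable G X T" "extendable G (verts G - X) T"
  shows "has_factor {4, 1} G"
proof -
  let ?Y = "verts G - X"
  obtain F1 F2 where F1: "F1 \<subseteq> edges G" "F1 \<inter> boundary G X = T" "\<forall>v\<in>X. sub_degree G F1 v \<in> {4, 1}"
    and F2: "F2 \<subseteq> edges G" "F2 \<inter> boundary G X = T" "\<forall>v\<in>?Y. sub_degree G F2 v \<in> {4, 1}"
    using assms(3,4) unfolding extendable_def boundary_Diff[OF G X] by metis
  define F where "F = (F1 \<inter> touching G X) \<union> (F2 \<inter> touching G ?Y)"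
  have F: "F \<subseteq> edges G" using F1 F2 by (auto simp: F_def)
  have both: "e \<in> boundary G X" if "e \<in> touching G X" "e \<in> touching G ?Y" for e
  proof -
    have "e \<in> edges G" "size (ends_in G X e) > 0" "size (ends_in G ?Y e) > 0"
      using that by (auto simp: touching_def nonempty_has_size)
    then show ?thesis using size_ends_in_Diff[OF G _ X, of e] by (auto simp: boundary_def)
  qed
  have "F \<inter> touching G X = F1 \<inter> touching G X" using both F1(2) F2(2) unfolding F_def by blast
  then have 1: "sub_degree G F v = sub_degree G F1 v" if "v \<in> X" for v
    using sub_degree_touching[OF G F that] sub_degree_touching[OF G F1(1) that] by simp
  have "F \<inter> touching G ?Y = F2 \<inter> touching G ?Y" using both F1(2) F2(2) unfolding F_def by blast
  then have 2: "sub_degree G F v = sub_degree G F2 v" if "v \<in> ?Y" for v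
    using sub_degree_touching[OF G F that] sub_degree_touching[OF G F2(1) that] by simp
  have "sub_degree G F v \<in> {4, 1}" if "v \<in> verts G" for v
    using 1[of v] 2[of v] F1(3) F2(3) that by (cases "v \<in> X") auto
  then show ?thesis unfolding has_factor_iff using F by (intro exI[of _ F]) simp
qed

lemma extendable_complement:
  assumes G: "pseudograph G" and reg: "regular 5 G" and X: "X \<subseteq> verts G" and "extendable G X T"
  shows "extendable G X (boundary G X - T)"
proof -
  obtain F where F: "F \<subseteq> edges G" "F \<inter> boundary G X = T" "\<forall>v\<in>X. sub_degree G F v \<in> {4, 1}"
    using assms(4) by (auto simp: extendable_def)
  have "sub_degree G (edges G - F) v \<in> {4, 1}" if "v \<in> X" for v
  proof -
    have "sub_degree G (edges G) v = sub_degree G (edges G - F) v + sub_degree G F v"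
      unfolding sub_degree_def using F(1) pseudographD(2)[OF G] by (rule sum.subset_diff)
    moreover have "sub_degree G (edges G) v = 5"
      using reg that X by (auto simp: regular_def vertex_degree_eq)
    ultimately show ?thesis using F(3) that by auto
  qed
  moreover have "(edges G - F) \<inter> boundary G X = boundary G X - T"
    using F(2) boundary_subset_edges[of G X] by blast
  ultimately show ?thesis by (intro extendableI[OF Diff_subset])
qed

text \<open>Minimality speaks of graphs on natural numbers, so \<open>H\<close> is transported along
  injections of its vertices and edges, and the factor is pulled back.\<close>

lemma has_factor_of_smaller:
  fixes G :: "('v, 'e) pgraph" and H :: "('a, 'b) pgraph"
  assumes min: "vertex_minimal_without_factor k S G"
    and H: "pseudograph H" "regular k H" "card (verts H) < card (verts G)"
  shows "has_factor S H"
proof -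
  have fin: "finite (verts H)" "finite (edges H)" using H(1) by (auto simp: pseudograph_def)
  obtain \<alpha> :: "'a \<Rightarrow> nat" where \<alpha>: "inj_on \<alpha> (verts H)"
    using finite_imp_inj_to_nat_seg[OF fin(1)] by blast
  obtain \<beta> :: "'b \<Rightarrow> nat" where \<beta>: "inj_on \<beta> (edges H)"
    using finite_imp_inj_to_nat_seg[OF fin(2)] by blast
  define K :: "(nat, nat) pgraph" where
    "K = \<lparr>verts = \<alpha> ` verts H, edges = \<beta> ` edges H,
          ends = (\<lambda>n. image_mset \<alpha> (ends H (inv_into (edges H) \<beta> n)))\<rparr>"
  have K: "verts K = \<alpha> ` verts H" "edges K = \<beta> ` edges H"
    and endsK: "ends K (\<beta> e) = image_mset \<alpha> (ends H e)" if "e \<in> edges H" for e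
    using \<beta> that by (auto simp: K_def inv_into_f_f)
  have VK: "verts K = \<alpha> ` verts H" and EK: "edges K = \<beta> ` edges H" by (auto simp: K_def)
  have count: "count (image_mset \<alpha> M) (\<alpha> v) = count M v"
    if "v \<in> verts H" "set_mset M \<subseteq> verts H" for M v
    using that(2)
  proof (induction M)
    case (add x M)
    then have "\<alpha> x = \<alpha> v \<longleftrightarrow> x = v" using that(1) \<alpha> by (auto dest: inj_onD)
    then show ?case using add by auto
  qed simp
  have deg: "sub_degree K (\<beta> ` F) (\<alpha> v) = sub_degree H F v" if "F \<subseteq> edges H" "v \<in> verts H" for F v
  proof -
    have "sub_degree K (\<beta> ` F) (\<alpha> v) = (\<Sum>e\<in>F. count (ends K (\<beta> e)) (\<alpha> v))"
      unfolding sub_degree_def using inj_on_subset[OF \<beta> that(1)] by (simp add: sum.reindex)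
    also have "\<dots> = sub_degree H F v"
      unfolding sub_degree_def
    proof (rule sum.cong)
      fix e assume "e \<in> F"
      then have "e \<in> edges H" using that by blast
      then show "count (ends K (\<beta> e)) (\<alpha> v) = count (ends H e) v"
        using count[OF that(2) pseudographD(4)[OF H(1)]] endsK by simp
    qed simp
    finally show ?thesis .
  qed
  have "pseudograph K"
    using fin endsK pseudographD(3,4)[OF H(1)]
    unfolding pseudograph_def VK EK by (auto simp: image_mono)
  moreover have "regular k K"
    using H(2) deg[OF order_refl] unfolding regular_def vertex_degree_eq VK EK by auto
  moreover have "card (verts K) < card (verts G)"
    using H(3) card_image[OF \<alpha>] by (simp add: VK)
  ultimately have "has_factor S K"
    using min unfolding vertex_minimal_without_factor_def by blast
  then obtain F where F: "F \<subseteq> edges K" "\<forall>v\<in>verts K. sub_degree K F v \<in> S"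
    by (auto simp: has_factor_iff)
  then obtain F' where F': "F' \<subseteq> edges H" "F = \<beta> ` F'" unfolding EK by (meson subset_imageE)
  then have "\<forall>v\<in>verts H. sub_degree H F' v \<in> S" using F(2) deg unfolding VK by auto
  then show ?thesis unfolding has_factor_iff using F' by (intro exI[of _ F']) simp
qed

section \<open>Degree counting over a vertex set\<close>

lemma degree_sum:
  assumes G: "pseudograph G" and reg: "regular k G" and X: "X \<subseteq> verts G"
  shows "k * card X = card (boundary G X) + 2 * card {e \<in> edges G. size (ends_in G X e) = 2}"
proof -
  have finX: "finite X" using X pseudographD(1)[OF G] finite_subset by blast
  have finE: "finite (edges G)" using pseudographD(2)[OF G] .
  \<comment> \<open>Double counting of incidences with \<open>X\<close>: a boundary edge contributes
    one, an edge inside \<open>X\<close> two.\<close>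
  have "k * card X = (\<Sum>v\<in>X. \<Sum>e\<in>edges G. count (ends G e) v)"
    using reg X by (simp add: regular_def vertex_degree_def subset_iff)
  also have "\<dots> = (\<Sum>e\<in>edges G. size (ends_in G X e))"
    by (subst sum.swap) (simp add: size_ends_in finX)
  also have "\<dots> = (\<Sum>e\<in>edges G. (if size (ends_in G X e) = 1 then 1 else 0) +
      2 * (if size (ends_in G X e) = 2 then 1 else 0))"
  proof (rule sum.cong)
    fix e assume "e \<in> edges G"
    then have "size (ends_in G X e) \<le> 2" by (rule size_ends_in_le[OF G])
    then consider "size (ends_in G X e) = 0" | "size (ends_in G X e) = 1" | "size (ends_in G X e) = 2"
      by linarith
    then show "size (ends_in G X e) = (if size (ends_in G X e) = 1 then 1 else 0) +
      2 * (if size (ends_in G X e) = 2 then 1 else 0)" by cases simp_all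
  qed simp
  also have "\<dots> = card (boundary G X) + 2 * card {e \<in> edges G. size (ends_in G X e) = 2}"
    using finE by (simp add: sum.distrib sum_distrib_left[symmetric] sum.If_cases boundary_def
        Collect_conj_eq Int_commute)
  finally show ?thesis .
qed

text \<open>Every edge meeting \<open>X\<close> contributes at least one incidence with
  \<open>X\<close>. This is the upper bound in the count for Tutte's condition.\<close>

lemma card_touching_le:
  assumes G: "pseudograph G" and reg: "regular k G" and X: "X \<subseteq> verts G"
  shows "card (touching G X) \<le> k * card X"
proof -
  have fin: "finite (edges G)" using pseudographD(2)[OF G] .
  have "touching G X \<subseteq> boundary G X \<union> {e \<in> edges G. size (ends_in G X e) = 2}"
  proof
    fix e assume "e \<in> touching G X"
    then have e: "e \<in> edges G" "size (ends_in G X e) \<noteq> 0" by (auto simp: touching_def)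
    then have "size (ends_in G X e) = 1 \<or> size (ends_in G X e) = 2"
      using size_ends_in_le[OF G, of e X] by linarith
    then show "e \<in> boundary G X \<union> {e \<in> edges G. size (ends_in G X e) = 2}"
      using e by (auto simp: boundary_def)
  qed
  then have "card (touching G X) \<le>
      card (boundary G X \<union> {e \<in> edges G. size (ends_in G X e) = 2})"
    using fin finite_boundary[OF G] by (intro card_mono) auto
  also have "\<dots> \<le> card (boundary G X) + card {e \<in> edges G. size (ends_in G X e) = 2}"
    by (rule card_Un_le)
  finally show ?thesis using degree_sum[OF assms] by linarith
qed

lemma loops_at_eq:
  assumes "pseudograph G"
  shows "loops_at G v = {e \<in> edges G. size (ends_in G {v} e) = 2}"
proof -
  have "ends G e = {#v, v#} \<longleftrightarrow> size (ends_in G {v} e) = 2" if e: "e \<in> edges G" for e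
  proof -
    obtain a b where "ends G e = {#a, b#}"
      using pseudographD(3)[OF assms e] by (rule size_eq_2_mset)
    then show ?thesis by (auto simp: ends_in_def add_eq_conv_diff)
  qed
  then show ?thesis by (auto simp: loops_at_def)
qed

text \<open>The degree count for a single vertex. For \<open>k = 5\<close>, one boundary edge goes
  with two loops and three boundary edges go with one loop.\<close>

lemma degree_loops:
  assumes "pseudograph G" "regular k G" "v \<in> verts G"
  shows "k = card (boundary G {v}) + 2 * card (loops_at G v)"
  using degree_sum[OF assms(1,2), of "{v}"] assms(3) by (simp add: loops_at_eq[OF assms(1)])

lemma boundary_singleton: "boundary G {v} = {e \<in> edges G. count (ends G e) v = 1}"
  by (simp add: boundary_def size_ends_in)

lemma boundary_doubleton:
  "x \<noteq> y \<Longrightarrow> boundary G {x, y} = {e \<in> edges G. count (ends G e) x + count (ends G e) y = 1}"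
  by (simp add: boundary_def size_ends_in)

section \<open>Edge cuts and boundaries\<close>

lemma disconnecting_imp_boundary:
  assumes G: "pseudograph G" and "verts G \<noteq> {}" and "\<not> graph_connected (del_edges G S)"
  obtains X where "X \<subseteq> verts G" "X \<noteq> {}" "X \<noteq> verts G" "boundary G X \<subseteq> S"
proof -
  have "verts (del_edges G S) = verts G" by (simp add: del_edges_def)
  then obtain u v where uv: "u \<in> verts G" "v \<in> verts G" "(u, v) \<notin> (adj (del_edges G S))\<^sup>*"
    using assms(2,3) by (auto simp: graph_connected_def)
  \<comment> \<open>\<open>X\<close> is the component of \<open>u\<close> after the deletion, so
    every edge leaving it was deleted.\<close>
  define X where "X = {w \<in> verts G. (u, w) \<in> (adj (del_edges G S))\<^sup>*}"
  have "boundary G X \<subseteq> S"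
  proof
    fix e assume e: "e \<in> boundary G X"
    then obtain a b where ab: "ends G e = {#a, b#}" "a \<in> X" "b \<notin> X" "b \<in> verts G"
      using boundaryE[OF e G] by blast
    have "e \<in> edges G" using e boundary_subset_edges[of G X] by blast
    show "e \<in> S"
    proof (rule ccontr)
      assume "e \<notin> S"
      then have "(a, b) \<in> adj (del_edges G S)"
        using \<open>e \<in> edges G\<close> ab(1) by (auto simp: adj_def del_edges_def)
      then have "b \<in> X" using ab unfolding X_def by (auto intro: rtrancl_into_rtrancl)
      then show False using ab by blast
    qed
  qed
  moreover have "u \<in> X" "v \<notin> X" using uv by (auto simp: X_def)
  ultimately show thesis using that[of X] uv by (auto simp: X_def)
qed

lemma boundary_imp_disconnecting:
  assumes G: "pseudograph G" and X: "X \<subseteq> verts G" "X \<noteq> {}" "X \<noteq> verts G" "boundary G X \<subseteq> S"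
  shows "\<not> graph_connected (del_edges G S)"
proof
  assume con: "graph_connected (del_edges G S)"
  obtain u v where uv: "u \<in> X" "v \<in> verts G" "v \<notin> X" using X by blast
  then have "(u, v) \<in> (adj (del_edges G S))\<^sup>*"
    using con X by (auto simp: graph_connected_def del_edges_def)
  then have "v \<in> X"
  proof (induction rule: rtrancl_induct)
    case base
    show ?case using uv by simp
  next
    case (step a b)
    then obtain e where e: "e \<in> edges G" "e \<notin> S" "ends G e = {#a, b#}"
      by (auto simp: adj_def del_edges_def)
    show ?case
    proof (rule ccontr)
      assume "b \<notin> X"
      then have "e \<in> boundary G X" using boundaryI e step.IH by metis
      then show False using X e by blast
    qed
  qed
  then show False using uv by simp
qed

lemma del_edges_empty: "del_edges G {} = G"
  by (simp add: del_edges_def)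

text \<open>Deleting \<open>S\<close> separates some \<open>X\<close> whose boundary lies in
  \<open>S\<close>. An edge of \<open>S\<close> off this boundary could be restored without
  reconnecting the graph, against minimality.\<close>

lemma minimal_edge_cut_boundary:
  assumes G: "pseudograph G" and "minimal_edge_cut G S"
  obtains X where "X \<subseteq> verts G" "X \<noteq> {}" "X \<noteq> verts G" "boundary G X = S"
proof -
  have cut: "graph_connected G" "\<not> graph_connected (del_edges G S)"
    and min: "\<And>e. e \<in> S \<Longrightarrow> graph_connected (del_edges G (S - {e}))"
    using assms(2) by (auto simp: minimal_edge_cut_def edge_cut_def)
  have "verts G \<noteq> {}" using cut by (simp add: graph_connected_def)
  then obtain X where X: "X \<subseteq> verts G" "X \<noteq> {}" "X \<noteq> verts G" "boundary G X \<subseteq> S"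
    using disconnecting_imp_boundary[OF G _ cut(2)] by blast
  have "e \<in> boundary G X" if "e \<in> S" for e
  proof (rule ccontr)
    assume "e \<notin> boundary G X"
    then have "boundary G X \<subseteq> S - {e}" using X by blast
    then show False using boundary_imp_disconnecting[OF G X(1-3)] min[OF that] by blast
  qed
  then show thesis using that[of X] X by blast
qed

lemma minimal_edge_cut_bridge: "bridge G e \<Longrightarrow> minimal_edge_cut G {e}"
  by (simp add: bridge_def minimal_edge_cut_def edge_cut_def del_edges_empty)

subsection \<open>Replacing one side of a cut\<close>

lemma card_less_of_outside:
  assumes "finite V" "X \<subseteq> V" "z \<in> V - X" "2 \<le> card (V - X)"
  shows "card (insert z X) < card V"
proof -
  have "finite X" using assms finite_subset by blast
  moreover have "card V = card (V - X) + card X"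
    using assms by (simp add: card_Diff_subset card_mono \<open>finite X\<close>)
  ultimately show ?thesis using assms by simp
qed

text \<open>The smaller graph keeps the edges at \<open>X\<close> and sends their outer ends to one vertex \<open>z\<close> carrying
  \<open>k\<close> loops, except that for \<open>e1 \<noteq> e2\<close> these two boundary edges are fused into a single edge with
  both ends in \<open>X\<close>. For \<open>k = 0\<close> there is no \<open>z\<close>.\<close>

lemma extendable_by_gadget:
  fixes G :: "('v, 'e) pgraph"
  assumes min: "vertex_minimal_without_factor 5 {4, 1} G"
    and X: "X \<subseteq> verts G" and z: "z \<in> verts G - X"
    and R: "R = (if e1 = e2 then {} else {e1, e2})" "R \<subseteq> boundary G X"
    and k: "if k = 0 then boundary G X = R else card (boundary G X - R) + 2 * k = 5 \<and> 2 \<le> card (verts G - X)"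
  obtains T j where "extendable G X T" "T \<subseteq> boundary G X" "e1 \<in> T \<longleftrightarrow> e2 \<in> T"
    "k \<noteq> 0 \<Longrightarrow> card (T - R) + 2 * j \<in> {4, 1}" "j \<le> k"
proof -
  have G: "pseudograph G" and reg: "regular 5 G"
    using min by (auto simp: vertex_minimal_without_factor_def)
  note fin = pseudographD(1,2)[OF G]
  \<comment> \<open>\<open>N e\<close> collects the ends of \<open>e\<close> in \<open>X\<close>; in
    the fused case \<open>e1\<close> also receives the inner end of \<open>e2\<close>, and
    \<open>B\<close> drops \<open>e2\<close>. Missing ends are filled with \<open>z\<close> in
    \<open>H\<close>.\<close>
  define N where "N e = ends_in G X e + (if e = e1 \<and> e1 \<noteq> e2 then ends_in G X e2 else {#})" for e
  define B where "B = touching G X - (R - {e1})"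
  define Z where "Z = (if k = 0 then {} else {z})"
  define H :: "('v, 'e + nat) pgraph" where
    "H = \<lparr>verts = X \<union> Z, edges = Inl ` B \<union> Inr ` {..<k},
          ends = case_sum (\<lambda>e. N e + replicate_mset (2 - size (N e)) z) (\<lambda>_. {#z, z#})\<rparr>"
  have VH: "verts H = X \<union> Z" and EH: "edges H = Inl ` B \<union> Inr ` {..<k}"
    and endsH: "ends H (Inl e) = N e + replicate_mset (2 - size (N e)) z" "ends H (Inr i) = {#z, z#}"
    for e i by (auto simp: H_def)
  have zX: "z \<notin> X" using z by simp
  have R_iff: "x \<in> R \<longleftrightarrow> e1 \<noteq> e2 \<and> (x = e1 \<or> x = e2)" for x by (simp add: R(1))
  have BE: "B \<subseteq> edges G" by (auto simp: B_def touching_def)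
  then have finB: "finite B" using fin finite_subset by blast
  have bdB: "boundary G X - R \<subseteq> B"
    using boundary_subset_touching[of G X] by (fastforce simp: B_def)
  have touch: "size (ends_in G X e) = (if e \<in> boundary G X then 1 else 2)" if "e \<in> touching G X" for e
  proof -
    have e: "e \<in> edges G" "size (ends_in G X e) \<noteq> 0" using that by (auto simp: touching_def)
    then have "size (ends_in G X e) = 1 \<or> size (ends_in G X e) = 2"
      using size_ends_in_le[OF G, of e X] by linarith
    then show ?thesis using e by (auto simp: boundary_def)
  qed
  have sizeN: "size (N e) = (if e \<in> boundary G X - R then 1 else 2)" if "e \<in> B" for e
  proof (cases "e = e1 \<and> e1 \<noteq> e2")
    case True
    then have "e1 \<in> boundary G X" "e2 \<in> boundary G X" "e1 \<in> R" using R(2) R_iff by blast+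
    then show ?thesis using True by (simp add: N_def boundary_def)
  next
    case False
    then have "e \<notin> R" using that R_iff unfolding B_def by blast
    then show ?thesis using False that touch[of e] by (auto simp: N_def B_def)
  qed
  have setN: "set_mset (N e) \<subseteq> X" for e by (auto simp: N_def ends_in_def)
  have "pseudograph H"
    unfolding pseudograph_def
  proof (intro conjI ballI)
    show "finite (verts H)" using X fin(1) finite_subset by (auto simp: VH Z_def)
    show "finite (edges H)" using finB by (simp add: EH)
    fix e' assume e': "e' \<in> edges H"
    show "size (ends H e') = 2"
      using e' sizeN by (auto simp: EH endsH)
    show "set_mset (ends H e') \<subseteq> verts H"
    proof (cases e')
      case (Inl e)
      then have e: "e \<in> B" using e' by (auto simp: EH)
      show ?thesis
      proof (cases "size (N e) = 2")
        case True
        then show ?thesis using Inl setN[of e] by (auto simp: endsH VH)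
      next
        case False
        then have "e \<in> boundary G X - R" using sizeN[OF e] by metis
        then have "k \<noteq> 0" using k by (auto split: if_splits)
        then show ?thesis using Inl setN[of e] by (auto simp: endsH VH Z_def split: if_splits)
      qed
    next
      case (Inr i)
      then have "k \<noteq> 0" using e' by (auto simp: EH)
      then show ?thesis using Inr by (simp add: endsH VH Z_def)
    qed
  qed
  have split: "sub_degree H F' v =
      (\<Sum>e | e \<in> B \<and> Inl e \<in> F'. count (ends H (Inl e)) v) + (\<Sum>i | i < k \<and> Inr i \<in> F'. count {#z, z#} v)"
    if "F' \<subseteq> edges H" for F' v
  proof -
    have "F' = Inl ` {e \<in> B. Inl e \<in> F'} \<union> Inr ` {i. i < k \<and> Inr i \<in> F'}" using that EH by auto
    then have "sub_degree H F' v =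
        (\<Sum>e'\<in>Inl ` {e \<in> B. Inl e \<in> F'} \<union> Inr ` {i. i < k \<and> Inr i \<in> F'}. count (ends H e') v)"
      by (simp add: sub_degree_def)
    also have "\<dots> = (\<Sum>e'\<in>Inl ` {e \<in> B. Inl e \<in> F'}. count (ends H e') v) +
        (\<Sum>e'\<in>Inr ` {i. i < k \<and> Inr i \<in> F'}. count (ends H e') v)"
      using finB by (intro sum.union_disjoint) auto
    also have "\<dots> = (\<Sum>e | e \<in> B \<and> Inl e \<in> F'. count (ends H (Inl e)) v) +
        (\<Sum>i | i < k \<and> Inr i \<in> F'. count {#z, z#} v)"
      by (simp add: sum.reindex endsH)
    finally show ?thesis .
  qed
  \<comment> \<open>This undoes the fusion: \<open>e1\<close> and \<open>e2\<close> are both chosen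
    exactly when the fused edge is.\<close>
  define lift where
    "lift F' = {e \<in> touching G X. if e \<in> R then Inl e1 \<in> F' else Inl e \<in> F'}" for F' :: "('e + nat) set"
  have liftE: "lift F' \<subseteq> edges G" for F' by (auto simp: lift_def touching_def)
  have deg_X: "sub_degree H F' v = sub_degree G (lift F') v" if F': "F' \<subseteq> edges H" and v: "v \<in> X" for F' v
  proof -
    let ?F0 = "{e \<in> B. Inl e \<in> F'}"
    have vz: "v \<noteq> z" using v zX by auto
    have R_touch: "R \<subseteq> touching G X" using R(2) boundary_subset_touching[of G X] by blast
    have "sub_degree H F' v = (\<Sum>e\<in>?F0. count (ends G e) v +
        (if e = e1 \<and> e1 \<noteq> e2 then count (ends G e2) v else 0))"
      unfolding split[OF F'] using vz
      by (auto simp: endsH N_def count_ends_in[OF v] intro!: sum.cong)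
    also have "\<dots> = sub_degree G ?F0 v +
        (\<Sum>e\<in>?F0. if e = e1 \<and> e1 \<noteq> e2 then count (ends G e2) v else 0)"
      by (simp add: sum.distrib sub_degree_def)
    also have "\<dots> = sub_degree G (lift F') v"
    proof (cases "e1 = e2 \<or> e1 \<notin> ?F0")
      case True
      then have "lift F' = ?F0" using R_touch by (auto simp: lift_def B_def R_iff)
      moreover have "(\<Sum>e\<in>?F0. if e = e1 \<and> e1 \<noteq> e2 then count (ends G e2) v else 0) = 0"
        using True by (intro sum.neutral) auto
      ultimately show ?thesis by simp
    next
      case False
      then have ne: "e1 \<noteq> e2" and e1: "e1 \<in> ?F0" by auto
      have "lift F' = insert e2 ?F0" "e2 \<notin> ?F0"
        using R_touch ne e1 by (auto simp: lift_def B_def R_iff)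
      moreover have "finite ?F0" using finB by simp
      ultimately show ?thesis using ne e1 by (simp add: sub_degree_def)
    qed
    finally show ?thesis .
  qed
  \<comment> \<open>The degree condition at \<open>z\<close> becomes the arithmetic constraint on
    the pattern, with \<open>j\<close> the number of chosen loops.\<close>
  have deg_z: "sub_degree H F' z = card ({e \<in> B. Inl e \<in> F'} \<inter> (boundary G X - R)) +
      2 * card {i. i < k \<and> Inr i \<in> F'}" if F': "F' \<subseteq> edges H" for F'
  proof -
    have "count (N e) z = 0" for e using setN[of e] zX by (auto simp: count_eq_zero_iff)
    then have "(\<Sum>e | e \<in> B \<and> Inl e \<in> F'. count (ends H (Inl e)) z) =
        (\<Sum>e\<in>{e \<in> B. Inl e \<in> F'}. if e \<in> boundary G X - R then 1 else 0)"
      using sizeN by (auto simp: endsH intro!: sum.cong)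
    also have "\<dots> = card ({e \<in> B. Inl e \<in> F'} \<inter> (boundary G X - R))"
      using finB by (simp add: sum.If_cases set_diff_eq)
    finally show ?thesis unfolding split[OF F'] by simp
  qed
  have "regular 5 H"
    unfolding regular_def vertex_degree_eq
  proof
    fix v assume "v \<in> verts H"
    then consider "v \<in> X" | "k \<noteq> 0" "v = z" by (auto simp: VH Z_def split: if_splits)
    then show "sub_degree H (edges H) v = 5"
    proof cases
      case 1
      have "R = {} \<or> e1 \<in> B"
        using R(2) R_iff boundary_subset_touching[of G X] unfolding B_def by blast
      then have "lift (edges H) = edges G \<inter> touching G X"
        by (auto simp: lift_def EH B_def touching_def R_iff split: if_splits)
      then show ?thesis
        using deg_X[OF order_refl 1] sub_degree_touching[OF G order_refl 1] reg 1 X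
        by (auto simp: regular_def vertex_degree_eq)
    next
      case 2
      have "{e \<in> B. Inl e \<in> edges H} = B" "{i. i < k \<and> Inr i \<in> edges H} = {..<k}"
        by (auto simp: EH)
      moreover have "B \<inter> (boundary G X - R) = boundary G X - R" using bdB by blast
      ultimately show ?thesis using deg_z[OF order_refl] k 2 by simp
    qed
  qed
  \<comment> \<open>For \<open>k = 0\<close> the outer side disappears entirely; otherwise at least
    two vertices shrink to one.\<close>
  moreover have "card (verts H) < card (verts G)"
  proof (cases "k = 0")
    case True
    have "X \<subset> verts G" using X z by blast
    then show ?thesis using True fin(1) by (simp add: VH Z_def psubset_card_mono)
  next
    case False
    then show ?thesis using card_less_of_outside[OF fin(1) X z] k by (simp add: VH Z_def)
  qed
  ultimately have "has_factor {4, 1} H" using has_factor_of_smaller[OF min \<open>pseudograph H\<close>] by blast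
  then obtain F' where F': "F' \<subseteq> edges H" "\<forall>v\<in>verts H. sub_degree H F' v \<in> {4, 1}"
    by (auto simp: has_factor_iff)
  let ?T = "lift F' \<inter> boundary G X" and ?j = "card {i. i < k \<and> Inr i \<in> F'}"
  show thesis
  proof (rule that)
    show "extendable G X ?T"
    proof (rule extendableI[OF liftE refl])
      fix v assume "v \<in> X"
      then show "sub_degree G (lift F') v \<in> {4, 1}"
        using F'(2) unfolding deg_X[OF F'(1) \<open>v \<in> X\<close>, symmetric] VH by blast
    qed
    show "e1 \<in> ?T \<longleftrightarrow> e2 \<in> ?T"
      using R(2) boundary_subset_touching[of G X] by (auto simp: lift_def R_iff)
    show "card (?T - R) + 2 * ?j \<in> {4, 1}" if "k \<noteq> 0"
    proof -
      have "?T - R = {e \<in> B. Inl e \<in> F'} \<inter> (boundary G X - R)"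
        using bdB boundary_subset_touching[of G X] by (auto simp: lift_def)
      moreover have "sub_degree H F' z \<in> {4, 1}" using F'(2) that by (auto simp: VH Z_def)
      ultimately show ?thesis using deg_z[OF F'(1)] by simp
    qed
    show "?j \<le> k" using card_mono[of "{..<k}" "{i. i < k \<and> Inr i \<in> F'}"] by auto
  qed simp
qed

section \<open>Extendable patterns on cuts of one, two and three edges\<close>

lemma extendable_one_edge:
  assumes min: "vertex_minimal_without_factor 5 {4, 1} G"
    and X: "X \<subseteq> verts G" and bd: "boundary G X = {e}" and "2 \<le> card (verts G - X)"
  shows "extendable G X {e}"
proof -
  have G: "pseudograph G" "regular 5 G"
    using min by (auto simp: vertex_minimal_without_factor_def)
  have "verts G - X \<noteq> {}" using assms(4) by force
  then obtain z where z: "z \<in> verts G - X" by blast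
  obtain T j where T: "extendable G X T" "T \<subseteq> boundary G X"
    \<comment> \<open>One boundary edge and two loops give \<open>z\<close> degree 5. The pattern
      found is empty or \<open>{e}\<close>, and complementation exchanges these.\<close>
    by (rule extendable_by_gadget[OF min X z, of "{}" e e 2]) (use bd assms(4) in auto)
  then have "T = {e} \<or> boundary G X - T = {e}" using bd by auto
  then show ?thesis using T(1) extendable_complement[OF G X T(1)] by metis
qed

lemma extendable_two_edges:
  assumes min: "vertex_minimal_without_factor 5 {4, 1} G"
    and X: "X \<subseteq> verts G" "X \<noteq> verts G" and bd: "boundary G X = {e, f}" and "e \<noteq> f"
  shows "extendable G X {e, f}"
proof -
  have G: "pseudograph G" "regular 5 G"
    using min by (auto simp: vertex_minimal_without_factor_def)
  obtain z where z: "z \<in> verts G - X" using X by blast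
  \<comment> \<open>Fusing \<open>e\<close> and \<open>f\<close> uses up the whole boundary, so no
    new vertex appears and the pattern contains both edges or neither.\<close>
  obtain T j where T: "extendable G X T" "T \<subseteq> boundary G X" "e \<in> T \<longleftrightarrow> f \<in> T"
    by (rule extendable_by_gadget[OF min X(1) z, of "{e, f}" e f 0]) (use bd \<open>e \<noteq> f\<close> in auto)
  then have "T = {e, f} \<or> boundary G X - T = {e, f}" using bd by auto
  then show ?thesis using T(1) extendable_complement[OF G X(1) T(1)] by metis
qed

lemma extendable_some_singleton:
  assumes min: "vertex_minimal_without_factor 5 {4, 1} G"
    and X: "X \<subseteq> verts G" and bd: "card (boundary G X) = 3" and "2 \<le> card (verts G - X)"
  shows "\<exists>e\<in>boundary G X. extendable G X {e}"
proof -
  have G: "pseudograph G" "regular 5 G"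
    using min by (auto simp: vertex_minimal_without_factor_def)
  have "verts G - X \<noteq> {}" using assms(4) by force
  then obtain z where z: "z \<in> verts G - X" by blast
  \<comment> \<open>Three boundary edges and one loop give \<open>z\<close> degree 5.\<close>
  obtain T j where T: "extendable G X T" "T \<subseteq> boundary G X" "card T + 2 * j \<in> {4, 1}" "j \<le> 1"
    by (rule extendable_by_gadget[OF min X z, of "{}" undefined undefined 1]) (use bd assms(4) in auto)
  have "card T \<le> 3" using card_mono[OF finite_boundary[OF G(1)] T(2)] bd by simp
  moreover have "card T + 2 * j = 4 \<or> card T + 2 * j = 1" using T(3) by simp
  \<comment> \<open>Degree 1 at \<open>z\<close> means one boundary edge and no loop; degree 4 with
    at most three boundary edges means two of them and the loop.\<close>
  ultimately have "card T = 1 \<or> card T = 2" using T(4) by presburger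
  moreover have "card (boundary G X - T) = 3 - card T"
    using card_Diff_subset[OF finite_subset[OF T(2) finite_boundary[OF G(1)]] T(2)] bd by simp
  ultimately obtain U where U: "extendable G X U" "U \<subseteq> boundary G X" "card U = 1"
    using T(1,2) extendable_complement[OF G X T(1)] by fastforce
  then show ?thesis by (auto simp: card_1_singleton_iff)
qed

lemma extendable_empty_or_singleton:
  assumes min: "vertex_minimal_without_factor 5 {4, 1} G"
    and X: "X \<subseteq> verts G" and bd: "card (boundary G X) = 3" and "2 \<le> card (verts G - X)"
    and g: "g \<in> boundary G X"
  shows "extendable G X {} \<or> extendable G X {g}"
proof -
  have G: "pseudograph G" "regular 5 G"
    using min by (auto simp: vertex_minimal_without_factor_def)
  have "verts G - X \<noteq> {}" using assms(4) by force
  then obtain z where z: "z \<in> verts G - X" by blast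
  have "card (boundary G X - {g}) = 2" using bd g by simp
  then obtain e f where ef: "boundary G X - {g} = {e, f}" "e \<noteq> f" by (auto simp: card_2_iff)
  then have bd': "boundary G X = {e, f, g}" "g \<noteq> e" "g \<noteq> f" using g by auto
  then have ports: "boundary G X - {e, f} = {g}" by auto
  \<comment> \<open>Fusing \<open>e\<close> and \<open>f\<close> leaves only \<open>g\<close> at
    \<open>z\<close>, and two loops complete its degree to 5. Four patterns treat \<open>e\<close>
    and \<open>f\<close> alike; up to complement these are the empty one and
    \<open>{g}\<close>.\<close>
  obtain T j where T: "extendable G X T" "T \<subseteq> boundary G X" "e \<in> T \<longleftrightarrow> f \<in> T"
    by (rule extendable_by_gadget[OF min X z, of "{e, f}" e f 2])
      (use bd' ef(2) ports assms(4) in auto)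
  have "T = {} \<or> T = {g} \<or> boundary G X - T = {} \<or> boundary G X - T = {g}"
    using T(2,3) bd' ef(2) by (cases "e \<in> T"; cases "g \<in> T") auto
  then show ?thesis using T(1) extendable_complement[OF G X T(1)] by metis
qed

subsection \<open>Perfect matchings in 4-edge-connected graphs\<close>

text \<open>By the degree count an odd set has a boundary of odd size, so the bound 4 rises to 5.
  The whole vertex set cannot be odd, because its boundary is empty.\<close>

lemma boundary_ge_5:
  assumes G: "pseudograph G" "regular 5 G"
    and four: "\<And>X. X \<subseteq> verts G \<Longrightarrow> X \<noteq> {} \<Longrightarrow> X \<noteq> verts G \<Longrightarrow> 4 \<le> card (boundary G X)"
    and C: "C \<subseteq> verts G" "odd (card C)"
  shows "5 \<le> card (boundary G C)"
proof -
  have odd: "odd (card (boundary G C))"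
  proof -
    have "odd (5 * card C)" using C(2) by simp
    then show ?thesis unfolding degree_sum[OF G C(1)] by simp
  qed
  have "C \<noteq> {}" using C(2) by auto
  moreover have "C \<noteq> verts G"
  proof
    assume "C = verts G"
    then have "boundary G C = boundary G {}" using boundary_Diff[OF G(1) C(1)] by simp
    also have "\<dots> = {}" by (simp add: boundary_def ends_in_def)
    finally show False using odd by simp
  qed
  ultimately have "4 \<le> card (boundary G C)" using four C(1) by blast
  moreover have "card (boundary G C) \<noteq> 4" using odd by auto
  ultimately show ?thesis by linarith
qed

definition adjacent :: "('v, 'e) pgraph \<Rightarrow> 'v \<Rightarrow> 'v \<Rightarrow> bool" where
  "adjacent G x y \<longleftrightarrow> (\<exists>e\<in>edges G. ends G e = {#x, y#})"

lemma adjacent_sym: "adjacent G x y \<Longrightarrow> adjacent G y x"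
  by (auto simp: adjacent_def add_mset_commute)

text \<open>The boundaries of the members of \<open>\<C>\<close> are disjoint, end in
  \<open>S\<close> and have at least 5 edges each, while at most \<open>5 * card S\<close> edges
  meet \<open>S\<close>.\<close>

lemma tutte_condition_of_4_edge_connected:
  assumes G: "pseudograph G" "regular 5 G"
    and four: "\<And>X. X \<subseteq> verts G \<Longrightarrow> X \<noteq> {} \<Longrightarrow> X \<noteq> verts G \<Longrightarrow> 4 \<le> card (boundary G X)"
  shows "tutte_condition (adjacent G) (verts G)"
  unfolding tutte_condition_def
proof (intro allI impI)
  fix S \<C>
  assume S: "S \<subseteq> verts G" and disj: "pairwise disjnt \<C>"
    and C: "\<forall>C\<in>\<C>. C \<subseteq> verts G - S \<and> odd (card C) \<and>
      (\<forall>x\<in>C. \<forall>y\<in>verts G - S. adjacent G x y \<longrightarrow> y \<in> C)"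
  have "\<C> \<subseteq> Pow (verts G)" using C by blast
  then have fin: "finite \<C>" using pseudographD(1)[OF G(1)] by (meson finite_Pow_iff finite_subset)
  have bd_ends: "\<exists>a b. ends G e = {#a, b#} \<and> a \<in> D \<and> b \<in> S"
    if e: "e \<in> boundary G D" and D: "D \<in> \<C>" for e D
  proof -
    obtain a b where ab: "ends G e = {#a, b#}" "a \<in> D" "b \<notin> D" "b \<in> verts G"
      using boundaryE[OF e G(1)] by metis
    have "e \<in> edges G" using e boundary_subset_edges[of G D] by blast
    then have "adjacent G a b" using ab(1) unfolding adjacent_def by blast
    then have "b \<in> S" using C D ab by blast
    then show ?thesis using ab by blast
  qed
  \<comment> \<open>A boundary edge has just one end outside \<open>S\<close>, and this end
    determines the member of the family.\<close>
  have dis: "boundary G D \<inter> boundary G D' = {}" if D: "D \<in> \<C>" "D' \<in> \<C>" "D \<noteq> D'" for D D'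
  proof (rule ccontr)
    assume "boundary G D \<inter> boundary G D' \<noteq> {}"
    then obtain e where e: "e \<in> boundary G D" "e \<in> boundary G D'" by blast
    obtain a b where ab: "ends G e = {#a, b#}" "a \<in> D" "b \<in> S" using bd_ends[OF e(1) D(1)] by blast
    obtain a' b' where ab': "ends G e = {#a', b'#}" "a' \<in> D'" "b' \<in> S" using bd_ends[OF e(2) D(2)] by blast
    have "a \<notin> S" "a' \<notin> S" using C D ab(2) ab'(2) by blast+
    then have "a = a'" using ab ab' by (auto simp: add_eq_conv_diff split: if_splits)
    then show False using disj D ab(2) ab'(2) by (auto simp: pairwise_def disjnt_def)
  qed
  have "5 * card \<C> \<le> (\<Sum>D\<in>\<C>. card (boundary G D))"
  proof -
    have "5 \<le> card (boundary G D)" if "D \<in> \<C>" for D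
      using C that by (intro boundary_ge_5[OF G four]) auto
    then have "(\<Sum>D\<in>\<C>. 5) \<le> (\<Sum>D\<in>\<C>. card (boundary G D))" by (rule sum_mono)
    then show ?thesis by simp
  qed
  also have "\<dots> = card (\<Union>D\<in>\<C>. boundary G D)"
    using fin dis finite_boundary[OF G(1)] by (intro card_UN_disjoint[symmetric]) auto
  also have "\<dots> \<le> card (touching G S)"
  proof (rule card_mono)
    show "finite (touching G S)" using pseudographD(2)[OF G(1)] by (simp add: touching_def)
    show "(\<Union>D\<in>\<C>. boundary G D) \<subseteq> touching G S"
    proof
      fix e assume "e \<in> (\<Union>D\<in>\<C>. boundary G D)"
      then obtain D where D: "D \<in> \<C>" "e \<in> boundary G D" by blast
      then obtain a b where "ends G e = {#a, b#}" "b \<in> S" using bd_ends by blast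
      then show "e \<in> touching G S"
        using D(2) by (auto simp: touching_def ends_in_def boundary_def)
    qed
  qed
  also have "\<dots> \<le> 5 * card S" by (rule card_touching_le[OF G S])
  finally show "card \<C> \<le> card S" by simp
qed

lemma has_factor_of_matchable:
  assumes "finite (verts G)" "matchable (adjacent G) (verts G)"
  shows "has_factor {4, 1} G"
proof -
  obtain f where f: "perfect_matching_on (adjacent G) (verts G) f"
    using assms by (auto simp: matchable_def)
  have fV: "f x \<in> verts G" "f (f x) = x" "f x \<noteq> x" "adjacent G x (f x)" if "x \<in> verts G" for x
    using f that by (auto simp: perfect_matching_on_def)
  \<comment> \<open>The edge is chosen from the multiset of its ends, so that both partners select
    the same one among parallel edges and every degree is exactly 1.\<close>
  define c where "c M = (SOME e. e \<in> edges G \<and> ends G e = M)" for M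
  have c: "c {#x, f x#} \<in> edges G" "ends G (c {#x, f x#}) = {#x, f x#}" if "x \<in> verts G" for x
  proof -
    have "\<exists>e. e \<in> edges G \<and> ends G e = {#x, f x#}" using fV(4)[OF that] by (auto simp: adjacent_def)
    from someI_ex[OF this] show "c {#x, f x#} \<in> edges G" "ends G (c {#x, f x#}) = {#x, f x#}"
      by (auto simp: c_def)
  qed
  define F where "F = (\<lambda>x. c {#x, f x#}) ` verts G"
  have finF: "finite F" using assms(1) by (simp add: F_def)
  have "sub_degree G F v = 1" if v: "v \<in> verts G" for v
  proof -
    have count: "count (ends G e) v = (if e = c {#v, f v#} then 1 else 0)" if e: "e \<in> F" for e
    proof (cases "e = c {#v, f v#}")
      case True
      then show ?thesis using c(2)[OF v] fV(3)[OF v] by simp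
    next
      case False
      obtain x where x: "x \<in> verts G" "e = c {#x, f x#}" using e by (auto simp: F_def)
      have "x \<noteq> v" using x False by auto
      moreover have "f x \<noteq> v"
      proof
        assume "f x = v"
        then have "{#x, f x#} = {#v, f v#}" using fV(2)[OF x(1)] by (auto simp: add_mset_commute)
        then show False using x False by simp
      qed
      ultimately show ?thesis using c(2)[OF x(1)] x(2) False by simp
    qed
    have "c {#v, f v#} \<in> F" using v by (auto simp: F_def)
    have "sub_degree G F v = (\<Sum>e\<in>F. if e = c {#v, f v#} then 1 else 0)"
      unfolding sub_degree_def using count by (rule sum.cong[OF refl])
    also have "\<dots> = 1" using finF \<open>c {#v, f v#} \<in> F\<close> by simp
    finally show ?thesis .
  qed
  then show ?thesis
    unfolding has_factor_iff using c(1) by (intro exI[of _ F]) (auto simp: F_def)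
qed

subsection \<open>Vertex-minimal graphs without a factor\<close>

locale minimal_without_factor =
  fixes G :: "('v, 'e) pgraph"
  assumes min: "vertex_minimal_without_factor 5 {4, 1} G"
begin

section \<open>Connectedness and the absence of minimal cuts of size 2\<close>

lemma pseudo: "pseudograph G" and reg: "regular 5 G" and no_factor: "\<not> has_factor {4, 1} G"
  using min by (auto simp: vertex_minimal_without_factor_def)

text \<open>A graph without vertices has a factor vacuously.\<close>

lemma verts_nonempty: "verts G \<noteq> {}"
  using no_factor by (auto simp: has_factor_iff)

text \<open>Across an empty boundary either side can be deleted: the gadget with
  \<open>k = 0\<close> and nothing to fuse makes the empty pattern extendable on both sides.\<close>

lemma boundary_nonempty:
  assumes X: "X \<subseteq> verts G" "X \<noteq> {}" "X \<noteq> verts G"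
  shows "boundary G X \<noteq> {}"
proof
  assume bd: "boundary G X = {}"
  have ext: "extendable G Y {}" if Y: "Y \<subseteq> verts G" "Y \<noteq> verts G" "boundary G Y = {}" for Y
  proof -
    obtain z where z: "z \<in> verts G - Y" using Y by blast
    obtain T j where "extendable G Y T" "T \<subseteq> boundary G Y"
      by (rule extendable_by_gadget[OF min Y(1) z, of "{}" undefined undefined 0]) (use Y in auto)
    then show ?thesis using Y by simp
  qed
  have "verts G - X \<noteq> verts G" using X by blast
  then have "extendable G (verts G - X) {}"
    using bd boundary_Diff[OF pseudo X(1)] by (intro ext) auto
  then show False using has_factor_glue[OF pseudo X(1) ext[OF X(1,3) bd]] no_factor by blast
qed

lemma connected: "graph_connected G"
proof (rule ccontr)
  assume "\<not> graph_connected G"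
  then have "\<not> graph_connected (del_edges G {})" by (simp add: del_edges_empty)
  then obtain X where "X \<subseteq> verts G" "X \<noteq> {}" "X \<noteq> verts G" "boundary G X \<subseteq> {}"
    using disconnecting_imp_boundary[OF pseudo verts_nonempty] by blast
  then show False using boundary_nonempty by blast
qed

text \<open>Each side can be closed up by fusing the two cut edges, so both sides admit the pattern
  \<open>{e, f}\<close>.\<close>

lemma no_minimal_cut_2:
  assumes "minimal_edge_cut G S"
  shows "card S \<noteq> 2"
proof
  assume "card S = 2"
  then obtain e f where S: "S = {e, f}" "e \<noteq> f" by (auto simp: card_2_iff)
  obtain X where X: "X \<subseteq> verts G" "X \<noteq> {}" "X \<noteq> verts G" "boundary G X = S"
    using minimal_edge_cut_boundary[OF pseudo assms] .
  have "verts G - X \<noteq> verts G" using X by blast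
  then have "extendable G (verts G - X) {e, f}"
    using boundary_Diff[OF pseudo X(1)] X(4) S by (intro extendable_two_edges[OF min]) auto
  moreover have "extendable G X {e, f}"
    using X S by (intro extendable_two_edges[OF min]) auto
  ultimately show False using has_factor_glue[OF pseudo X(1)] no_factor by blast
qed

lemma one_or_two_le_card:
  assumes "X \<subseteq> verts G" "X \<noteq> {}"
  obtains v where "X = {v}" | "2 \<le> card X"
proof -
  have "finite X" using assms pseudographD(1)[OF pseudo] finite_subset by blast
  then have "card X \<noteq> 0" using assms by simp
  then have "card X = 1 \<or> 2 \<le> card X" by linarith
  then show thesis using that by (auto simp: card_1_singleton_iff)
qed

section \<open>Bridges\<close>

lemma extendable_singleton:
  assumes "v \<in> verts G" "boundary G {v} = {e}"
  shows "extendable G {v} {e}"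
  using assms by (intro extendableI[of "{e}"]) (auto simp: boundary_singleton sub_degree_def)

text \<open>The pattern \<open>{e}\<close> extends over any side whose complement has at least two
  vertices, and over any side that is a single vertex. As the two sides cannot both admit it,
  exactly one of them is a single vertex.\<close>

lemma bridge_leaf:
  assumes "bridge G e"
  obtains x where "x \<in> verts G" "boundary G {x} = {e}" "2 \<le> card (verts G - {x})"
proof -
  obtain X where X: "X \<subseteq> verts G" "X \<noteq> {}" "X \<noteq> verts G" "boundary G X = {e}"
    using minimal_edge_cut_boundary[OF pseudo minimal_edge_cut_bridge[OF assms]] .
  let ?Y = "verts G - X"
  have Y: "?Y \<subseteq> verts G" "?Y \<noteq> {}" "boundary G ?Y = {e}" "verts G - ?Y = X"
    using X boundary_Diff[OF pseudo X(1)] by auto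
  have no: "\<not> (extendable G X {e} \<and> extendable G ?Y {e})"
    using has_factor_glue[OF pseudo X(1)] no_factor by blast
  consider x where "X = {x}" | "2 \<le> card X" using one_or_two_le_card[OF X(1,2)] by blast
  then show thesis
  proof cases
    case 1
    then have "extendable G X {e}" using X extendable_singleton by simp
    moreover have "extendable G ?Y {e}" if "?Y = {y}" for y
      using extendable_singleton[of y e] Y that by auto
    ultimately have "2 \<le> card ?Y" using no one_or_two_le_card[OF Y(1,2)] by metis
    then show thesis using that[of x] X 1 by simp
  next
    case 2
    then have extY: "extendable G ?Y {e}" using extendable_one_edge[OF min Y(1,3)] Y(4) by simp
    then have "\<not> 2 \<le> card ?Y" using no extendable_one_edge[OF min X(1,4)] by blast
    then obtain y where "?Y = {y}" using one_or_two_le_card[OF Y(1,2)] by metis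
    then show thesis using that[of y] Y 2 by auto
  qed
qed

lemma leaf_ends:
  assumes "boundary G {x} = {e}"
  obtains y where "ends G e = {#x, y#}" "x \<noteq> y" "y \<in> verts G"
proof -
  have "e \<in> boundary G {x}" using assms by simp
  then obtain a b where "ends G e = {#a, b#}" "a \<in> {x}" "b \<notin> {x}" "b \<in> verts G"
    using boundaryE[OF _ pseudo] by metis
  then show thesis using that[of b] by auto
qed

lemma count_ends_le:
  assumes "x \<noteq> y" "e \<in> edges G"
  shows "count (ends G e) x + count (ends G e) y \<le> 2"
  using size_ends_in_le[OF pseudo assms(2), of "{x, y}"] assms(1) by (simp add: size_ends_in)

text \<open>Two bridges would hang on leaves \<open>x\<close> and \<open>y\<close>. The edges
  \<open>e\<close> and \<open>f\<close> form the boundary of \<open>{x, y}\<close> and alone give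
  both leaves degree 1; fusing them on the other side extends the same pattern there.\<close>

lemma bridge_unique:
  assumes "bridge G e" "bridge G f"
  shows "e = f"
proof (rule ccontr)
  assume "e \<noteq> f"
  obtain x where x: "x \<in> verts G" "boundary G {x} = {e}" using bridge_leaf[OF assms(1)] .
  obtain y where y: "y \<in> verts G" "boundary G {y} = {f}" using bridge_leaf[OF assms(2)] .
  have xy: "x \<noteq> y" using x y \<open>e \<noteq> f\<close> by auto
  have 1: "count (ends G d) x = 1 \<longleftrightarrow> d = e" "count (ends G d) y = 1 \<longleftrightarrow> d = f" if "d \<in> edges G" for d
    using x(2) y(2) that unfolding boundary_singleton by blast+
  have E: "e \<in> edges G" "f \<in> edges G" using x(2) y(2) unfolding boundary_singleton by blast+
  have one: "count (ends G e) x = 1" "count (ends G f) y = 1" using 1 E by blast+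
  have "count (ends G e) y \<noteq> 1" "count (ends G f) x \<noteq> 1" using 1 E \<open>e \<noteq> f\<close> by blast+
  \<comment> \<open>No bridge joins the leaves: \<open>e\<close> has one end at \<open>x\<close>, so
    at most one at \<open>y\<close>, and exactly one is excluded since \<open>f\<close> is the only
    boundary edge of \<open>{y}\<close>. The same holds for \<open>f\<close>.\<close>
  then have "count (ends G e) y = 0" "count (ends G f) x = 0"
    using one count_ends_le[OF xy E(1)] count_ends_le[OF xy E(2)] by arith+
  note c = one this
  have "boundary G {x, y} = {e, f}"
    unfolding boundary_doubleton[OF xy]
  proof (intro equalityI subsetI)
    fix d assume "d \<in> {e \<in> edges G. count (ends G e) x + count (ends G e) y = 1}"
    then have "d \<in> edges G" "count (ends G d) x = 1 \<or> count (ends G d) y = 1" by auto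
    then show "d \<in> {e, f}" using 1 by blast
  qed (use c E in auto)
  moreover have XV: "{x, y} \<subseteq> verts G" using x y by simp
  moreover have "extendable G {x, y} {e, f}"
    using c E calculation \<open>e \<noteq> f\<close>
    by (intro extendableI[of "{e, f}"]) (auto simp: sub_degree_def)
  moreover have "extendable G (verts G - {x, y}) {e, f}"
    using x(1) calculation boundary_Diff[OF pseudo XV] \<open>e \<noteq> f\<close> by (intro extendable_two_edges[OF min]) auto
  ultimately show False using has_factor_glue[OF pseudo] no_factor by blast
qed

text \<open>The leaf \<open>x\<close> has two loops by its degree. If the other end \<open>y\<close>
  had two as well, \<open>{x, y}\<close> would be cut off from the remaining vertices, which exist
  by the size bound on the complement of the leaf.\<close>

lemma bridge_loops:
  assumes "bridge G e"
  shows "\<exists>!v. v \<in># ends G e \<and> card (loops_at G v) = 2"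
proof -
  obtain x where x: "x \<in> verts G" "boundary G {x} = {e}" "2 \<le> card (verts G - {x})"
    using bridge_leaf[OF assms] .
  obtain y where y: "ends G e = {#x, y#}" "x \<noteq> y" "y \<in> verts G" using leaf_ends[OF x(2)] .
  have "card (loops_at G x) = 2" using degree_loops[OF pseudo reg x(1)] x(2) by simp
  moreover have "card (loops_at G y) \<noteq> 2"
  proof
    assume "card (loops_at G y) = 2"
    then have "card (boundary G {y}) = 1" using degree_loops[OF pseudo reg y(3)] by simp
    moreover have E: "e \<in> edges G" using x(2) by (auto simp: boundary_singleton)
    then have "e \<in> boundary G {y}" using y by (auto simp: boundary_singleton)
    ultimately have bdy: "boundary G {y} = {e}" by (auto simp: card_1_singleton_iff)
    have "boundary G {x, y} = {}"
    proof (rule ccontr)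
      assume "boundary G {x, y} \<noteq> {}"
      then obtain d where d: "d \<in> edges G" "count (ends G d) x + count (ends G d) y = 1"
        unfolding boundary_doubleton[OF y(2)] by blast
      then have "count (ends G d) x = 1 \<or> count (ends G d) y = 1" by linarith
      then have "d \<in> boundary G {x} \<union> boundary G {y}" using d(1) by (auto simp: boundary_singleton)
      then have "d = e" using x(2) bdy by simp
      then show False using d(2) y(1,2) by simp
    qed
    moreover have "{x, y} \<noteq> verts G"
    proof
      assume "{x, y} = verts G"
      then have "verts G - {x} = {y}" using y(2) by auto
      then show False using x(3) by simp
    qed
    ultimately show False using boundary_nonempty[of "{x, y}"] x(1) y(3) by simp
  qed
  ultimately show ?thesis using y(1) by (intro ex1I[of _ x]) auto
qed

section \<open>Cuts of size 3\<close>

lemma minimal_cut_3: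
  assumes "minimal_edge_cut G S" "card S = 3"
  shows "\<exists>v. (\<forall>e\<in>S. v \<in># ends G e) \<and> loops_at G v \<noteq> {}"
proof -
  obtain X where X: "X \<subseteq> verts G" "X \<noteq> {}" "X \<noteq> verts G" "boundary G X = S"
    using minimal_edge_cut_boundary[OF pseudo assms(1)] .
  let ?Y = "verts G - X"
  have Y: "?Y \<subseteq> verts G" "?Y \<noteq> {}" "boundary G ?Y = S" "verts G - ?Y = X"
    using X boundary_Diff[OF pseudo X(1)] by auto
  have no: "\<not> (extendable G X T \<and> extendable G ?Y T)" for T
    using has_factor_glue[OF pseudo X(1)] no_factor by blast
  have "\<not> (2 \<le> card X \<and> 2 \<le> card ?Y)"
  proof
    assume c: "2 \<le> card X \<and> 2 \<le> card ?Y"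
    have X1: "\<exists>e\<in>S. extendable G X {e}" and X2: "extendable G X {} \<or> extendable G X {g}" if "g \<in> S" for g
      using extendable_some_singleton[OF min X(1)] extendable_empty_or_singleton[OF min X(1)]
        X(4) assms(2) c that by auto
    have Y1: "\<exists>e\<in>S. extendable G ?Y {e}" and Y2: "extendable G ?Y {} \<or> extendable G ?Y {g}" if "g \<in> S" for g
      using extendable_some_singleton[OF min Y(1)] extendable_empty_or_singleton[OF min Y(1)]
        Y(3,4) assms(2) c that by auto
    have "S \<noteq> {}" using assms(2) by auto
    \<comment> \<open>If both sides admit the empty pattern, they share it. Otherwise one side
      admits every singleton, and the other admits some singleton.\<close>
    then show False using X1 X2 Y1 Y2 no by blast
  qed
  then obtain v where v: "v \<in> verts G" "boundary G {v} = S"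
    using one_or_two_le_card[OF X(1,2)] one_or_two_le_card[OF Y(1,2)] X Y by (metis insert_subset)
  have "loops_at G v \<noteq> {}" using degree_loops[OF pseudo reg v(1)] v(2) assms(2) by auto
  moreover have "v \<in># ends G e" if "e \<in> S" for e
    using that v(2) by (auto simp: boundary_singleton simp flip: count_greater_zero_iff)
  ultimately show ?thesis by blast
qed

text \<open>If no three edges disconnect \<open>G\<close>, every proper nonempty vertex set has at
  least 4 boundary edges, since a smaller boundary could be enlarged to a cut of exactly 3. Tutte's
  theorem then gives a perfect matching, hence a factor.\<close>

lemma exists_cut_3: "\<exists>S. edge_cut G S \<and> card S = 3"
proof (rule ccontr)
  assume no: "\<nexists>S. edge_cut G S \<and> card S = 3"
  have fin: "finite (edges G)" using pseudographD(2)[OF pseudo] .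
  obtain v where v: "v \<in> verts G" using verts_nonempty by blast
  have "boundary G {v} \<inter> loops_at G v = {}"
    by (auto simp: loops_at_def boundary_singleton)
  then have "card (boundary G {v} \<union> loops_at G v) = card (boundary G {v}) + card (loops_at G v)"
    using fin by (intro card_Un_disjoint) (auto simp: loops_at_def boundary_def)
  moreover have "card (boundary G {v} \<union> loops_at G v) \<le> card (edges G)"
    using fin by (intro card_mono) (auto simp: loops_at_def boundary_def)
  \<comment> \<open>Enough edges exist for the enlargement: if \<open>v\<close> has \<open>b\<close>
    boundary edges and \<open>l\<close> loops, \<open>b + 2 * l = 5\<close> gives
    \<open>b + l \<ge> 3\<close>.\<close>
  ultimately have three: "3 \<le> card (edges G)" using degree_loops[OF pseudo reg v] by linarith
  have "4 \<le> card (boundary G X)" if X: "X \<subseteq> verts G" "X \<noteq> {}" "X \<noteq> verts G" for X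
  proof (rule ccontr)
    assume "\<not> 4 \<le> card (boundary G X)"
    then have "card (boundary G X) \<le> 3" by simp
    then obtain S where S: "boundary G X \<subseteq> S" "S \<subseteq> edges G" "card S = 3"
      using exists_subset_between[OF _ three boundary_subset_edges fin] by blast
    then have "edge_cut G S"
      using boundary_imp_disconnecting[OF pseudo X S(1)] connected by (simp add: edge_cut_def)
    then show False using no S(3) by blast
  qed
  then have "tutte_condition (adjacent G) (verts G)"
    by (rule tutte_condition_of_4_edge_connected[OF pseudo reg])
  then have "matchable (adjacent G) (verts G)"
    using tutte_matchable[OF pseudographD(1)[OF pseudo]] adjacent_sym by metis
  then show False using has_factor_of_matchable[OF pseudographD(1)[OF pseudo]] no_factor by blast
qed

end

theorem theorem7:
  fixes G :: "('v, 'e) pgraph"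
  assumes "vertex_minimal_without_factor 5 {4, 1} G"
  shows "graph_connected G \<and>
    (\<not> edge_connected 4 G \<and> (\<exists>S. edge_cut G S \<and> card S = 3)) \<and>
    \<not> (\<exists>S. minimal_edge_cut G S \<and> card S = 2) \<and>
    \<not> (\<exists>e f. bridge G e \<and> bridge G f \<and> e \<noteq> f) \<and>
    (\<forall>e. bridge G e \<longrightarrow> (\<exists>!v. v \<in># ends G e \<and> card (loops_at G v) = 2)) \<and>
    (\<forall>S. minimal_edge_cut G S \<and> card S = 3 \<longrightarrow>
       (\<exists>v. (\<forall>e \<in> S. v \<in># ends G e) \<and> loops_at G v \<noteq> {}))"
proof -
  interpret minimal_without_factor G by (rule minimal_without_factor.intro[OF assms])
  show ?thesis
  proof (intro conjI)
    obtain S where S: "edge_cut G S" "card S = 3" using exists_cut_3 by blast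
    then show "\<not> edge_connected 4 G" by (fastforce simp: edge_connected_def)
    show "\<exists>S. edge_cut G S \<and> card S = 3" by (rule exists_cut_3)
    show "graph_connected G" by (rule connected)
    show "\<not> (\<exists>S. minimal_edge_cut G S \<and> card S = 2)" using no_minimal_cut_2 by blast
    show "\<not> (\<exists>e f. bridge G e \<and> bridge G f \<and> e \<noteq> f)" using bridge_unique by blast
    show "\<forall>e. bridge G e \<longrightarrow> (\<exists>!v. v \<in># ends G e \<and> card (loops_at G v) = 2)"
      using bridge_loops by blast
    show "\<forall>S. minimal_edge_cut G S \<and> card S = 3 \<longrightarrow>
         (\<exists>v. (\<forall>e \<in> S. v \<in># ends G e) \<and> loops_at G v \<noteq> {})"
      using minimal_cut_3 by blast
  qed
qed

end
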